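(* Let $\Gamma$ be a finite connected metric graph (not a point and not homeomorphic to $[0,1]$ or $S^1$), let $n\ge2$, and let $\mathbf r,\mathbf s\in\Omega=\{\mathbf r\in\mathbb{R}^{\binom n2}\mid r_{ij}\ge0\}$. If $\mathbf r\sim\mathbf s$, then $\Gamma^n_{\mathbf r}$ is isotopic to $\Gamma^n_{\mathbf s}$ in $\Gamma^n$.
   Context: Graphs. A metric graph $\Gamma$ is a finite connected one-dimensional CW complex with a positive length $L_e$ assigned to each edge $e$; $\delta$ is the resulting path metric. Multiple edges are allowed; the underlying space is not a point and not homeomorphic to $[0,1]$ or $S^1$. $\Gamma$ has its minimal regular cell structure (no node of valence two, except that each loop is subdivided at its midpoint). Each edge $e$ is identified with $[0,L_e]$. For $\mathbf r=(r_{ij})_{1\le i<j\le n}$ (with $r_{ji}=r_{ij}$), $$\Gamma^n_{\mathbf r}=\{(x_1,\dots,x_n)\in\Gamma^n\mid\delta(x_i,x_j)\ge r_{ij}\ \forall i<j\}.$$ Types of parametric polytopes. Given a finite index set $\Lambda$, rows $A_\lambda\in\mathbb{R}^n$ $(\lambda\in\Lambda)$ and $\mathbf b\in\mathbb{R}^\Lambda$, consider the polytope $\{x\in\mathbb{R}^n\mid A_\lambda x\le b_\lambda\ \forall\lambda\}$. A subset $\beta\subseteq\Lambda$ is basic if the submatrix $\mathbf A_\beta$ with rows $A_\lambda$, $\lambda\in\beta$, is an invertible $n\times n$ matrix; put $\mathbf b_\beta=(b_\lambda)_{\lambda\in\beta}$. Let $S_{\mathbf b}$ be the set of basic $\beta$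 with $A_\lambda\mathbf A_\beta^{-1}\mathbf b_\beta\le b_\lambda$ for all $\lambda\in\Lambda$, let $v_{\mathbf b}(\beta)=\{\lambda\in\Lambda\mid A_\lambda\mathbf A_\beta^{-1}\mathbf b_\beta=b_\lambda\}$, and define the type $T_{\mathbf b}=\{v_{\mathbf b}(\beta)\mid\beta\in S_{\mathbf b}\}$. Cells. The product $\Gamma^n$ is given the cell structure whose maximal cells $c$ are obtained from products $e_1\times\cdots\times e_n$ of edges by choosing, for each edge repeated in the product, a linear order $x_{\sigma(1)}\le\cdots\le x_{\sigma(k)}$ of the coordinates lying on that edge; the other cells are the faces of these. Let $a_i,b_i$ be the endpoints of $e_i$ corresponding to $0$ and $L_{e_i}$. For a maximal cell $c$, the polytope $c_{\mathbf r}=c\cap\Gamma^n_{\mathbf r}$ is described in coordinates $(x_1,\dots,x_n)\in\mathbb{R}^n$ by the following labelled inequalities, whose labels form the index set $\Lambda^c$: - for $1\le i\le n$: $C^i_1$: $-x_i\le0$; $C^i_2$: $x_i\le L_{e_i}$; - for $i<j$ with $e_i\ne e_j$: $D^{ij}_1$: $-x_i-x_j\le-r_{ij}+\delta(a_i,a_j)$; $D^{ij}_2$: $-x_i+x_j\le-r_{ij}+\delta(a_i,b_j)+L_{e_j}$; $D^{ij}_3$: $x_i-x_j\le-r_{ij}+\delta(b_i,a_j)+L_{e_i}$; $D^{ij}_4$: $x_i+x_j\le-r_{ij}+\delta(b_i,b_j)+L_{e_i}+L_{e_j}$; - for $i\neq j$ with $e_i=e_j$ and $x_i\le x_j$ in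 $c$: $E^{ij}_1$: $x_i-x_j\le0$; $E^{ij}_2$: $x_i-x_j\le-r_{ij}$; $E^{ij}_3$: $-x_i+x_j\le-r_{ij}+\delta(a_i,b_i)+L_{e_i}$. $T^c_{\mathbf r}$ denotes the type of this system. A lower-dimensional cell $d$ that is a face of $c$ is obtained by turning a set $\tau$ of inequalities with labels of the form $C^i_1,C^i_2,E^{ij}_1$ into equalities; $d_{\mathbf r}=d\cap\Gamma^n_{\mathbf r}$ is described by the remaining inequalities in $\dim d$ variables (discarding inequalities that become redundant independently of $\mathbf r$), and $T^d_{\mathbf r}$ is the type of that system; the vertices of $d_{\mathbf r}$ correspond exactly to the elements of $T^c_{\mathbf r}$ containing $\tau$. Equivalence. For $\mathbf r,\mathbf s\in\Omega$, $\mathbf r\sim\mathbf s$ means $T^c_{\mathbf r}=T^c_{\mathbf s}$ for every cell $c$ of $\Gamma^n$ (equivalently, for every maximal cell). Isotopy. Subspaces $X,Y\subseteq\Gamma^n$ are isotopic in $\Gamma^n$ if there is a continuous map $\Phi\colon X\times[0,1]\to\Gamma^n$ such that $\Phi(-,0)$ is the inclusion of $X$, each $\Phi(-,t)$ is a homeomorphism onto its image, and $\Phi(-,1)$ has image $Y$. *)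

theory Defs
  imports "HOL-Analysis.Analysis"
begin

section \<open>Metric graphs\<close>

record ('a, 'e) graph_complex =
  gspace :: "'a topology"
  nodes :: "'a set"
  edges :: "'e set"
  len :: "'e \<Rightarrow> real"
  chart :: "'e \<Rightarrow> real \<Rightarrow> 'a"

text \<open>
  The axioms of a finite CW complex of dimension at most one, with the characteristic map of an
  edge \<open>e\<close> parametrised by \<open>[0, len e]\<close>. As there are only finitely many cells, the Hausdorff
  property gives the weak topology, and (closed intervals being compact) that every chart is a
  homeomorphism from the open interval onto the open edge.
\<close>

definition metric_graph :: "('a, 'e) graph_complex \<Rightarrow> bool" where
  "metric_graph G \<longleftrightarrow>
     Hausdorff_space (gspace G) \<and> connected_space (gspace G) \<and> topspace (gspace G) \<noteq> {} \<and>
     finite (nodes G) \<and> finite (edges G) \<and>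
     topspace (gspace G) = nodes G \<union> (\<Union>e\<in>edges G. chart G e ` {0<..<len G e}) \<and>
     (\<forall>e\<in>edges G. 0 < len G e \<and>
        continuous_map (top_of_set {0..len G e}) (gspace G) (chart G e) \<and>
        inj_on (chart G e) {0<..<len G e} \<and>
        chart G e 0 \<in> nodes G \<and> chart G e (len G e) \<in> nodes G \<and>
        chart G e ` {0<..<len G e} \<inter> nodes G = {}) \<and>
     disjoint_family_on (\<lambda>e. chart G e ` {0<..<len G e}) (edges G)"

definition end0 :: "('a, 'e) graph_complex \<Rightarrow> 'e \<Rightarrow> 'a" where
  "end0 G e = chart G e 0"

definition end1 :: "('a, 'e) graph_complex \<Rightarrow> 'e \<Rightarrow> 'a" where
  "end1 G e = chart G e (len G e)"

text \<open>Edge ends are counted, so an edge with both ends at \<open>v\<close> contributes two.\<close>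

definition valence :: "('a, 'e) graph_complex \<Rightarrow> 'a \<Rightarrow> nat" where
  "valence G v = card {e \<in> edges G. end0 G e = v} + card {e \<in> edges G. end1 G e = v}"

text \<open>
  \<open>v\<close> subdivides a loop based at the node \<open>w\<close> into two halves of equal length.
\<close>

definition loop_midpoint :: "('a, 'e) graph_complex \<Rightarrow> 'a \<Rightarrow> bool" where
  "loop_midpoint G v \<longleftrightarrow>
     (\<exists>w\<in>nodes G. \<exists>e\<in>edges G. \<exists>e'\<in>edges G. w \<noteq> v \<and> valence G w \<noteq> 2 \<and> e \<noteq> e' \<and>
        {end0 G e, end1 G e} = {v, w} \<and> {end0 G e', end1 G e'} = {v, w} \<and> len G e = len G e')"

definition minimal_regular :: "('a, 'e) graph_complex \<Rightarrow> bool" where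
  "minimal_regular G \<longleftrightarrow>
     (\<forall>e\<in>edges G. inj_on (chart G e) {0..len G e}) \<and>
     (\<forall>v\<in>nodes G. valence G v = 2 \<longrightarrow> loop_midpoint G v)"

text \<open>
  A path is a list of segments \<open>(e, s, t)\<close>, each running along the edge \<open>e\<close> from parameter \<open>s\<close> to
  parameter \<open>t\<close>; the path metric is the infimum of the lengths of such paths.
\<close>

fun edge_path :: "('a, 'e) graph_complex \<Rightarrow> 'a \<Rightarrow> ('e \<times> real \<times> real) list \<Rightarrow> 'a \<Rightarrow> bool" where
  "edge_path G x [] y \<longleftrightarrow> x = y"
| "edge_path G x ((e, s, t) # p) y \<longleftrightarrow>
     e \<in> edges G \<and> s \<in> {0..len G e} \<and> t \<in> {0..len G e} \<and> chart G e s = x \<and>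
     edge_path G (chart G e t) p y"

definition path_len :: "('e \<times> real \<times> real) list \<Rightarrow> real" where
  "path_len p = (\<Sum>(e, s, t)\<leftarrow>p. \<bar>s - t\<bar>)"

definition gdist :: "('a, 'e) graph_complex \<Rightarrow> 'a \<Rightarrow> 'a \<Rightarrow> real" where
  "gdist G x y = Inf {path_len p |p. edge_path G x p y}"


section \<open>Configuration spaces\<close>

text \<open>
  The index set \<open>{1, \<dots>, n}\<close> is a finite linearly ordered type \<open>'n\<close>. A vector \<open>r\<close> in \<open>\<real>\<close> to the
  power \<open>n choose 2\<close> is a symmetric function of two indices, whose values on the diagonal are
  never used.
\<close>

definition param_space :: "('n \<Rightarrow> 'n \<Rightarrow> real) set" where
  "param_space = {r. \<forall>i j. i \<noteq> j \<longrightarrow> r i j = r j i \<and> 0 \<le> r i j}"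

definition gpower :: "('a, 'e) graph_complex \<Rightarrow> ('n \<Rightarrow> 'a) topology" where
  "gpower G = product_topology (\<lambda>_. gspace G) UNIV"

definition conf_space ::
  "('a, 'e) graph_complex \<Rightarrow> ('n::linorder \<Rightarrow> 'n \<Rightarrow> real) \<Rightarrow> ('n \<Rightarrow> 'a) set" where
  "conf_space G r =
     {x \<in> topspace (gpower G). \<forall>i j. i < j \<longrightarrow> r i j \<le> gdist G (x i) (x j)}"

definition isotopic_in :: "'a topology \<Rightarrow> 'a set \<Rightarrow> 'a set \<Rightarrow> bool" where
  "isotopic_in Z X Y \<longleftrightarrow>
     (\<exists>\<Phi>. continuous_map (prod_topology (subtopology Z X) (top_of_set {0..1::real})) Z \<Phi> \<and>
        (\<forall>x\<in>X. \<Phi> (x, 0) = x) \<and>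
        (\<forall>t\<in>{0..1}. embedding_map (subtopology Z X) Z (\<lambda>x. \<Phi> (x, t))) \<and>
        (\<lambda>x. \<Phi> (x, 1)) ` X = Y)"


section \<open>Types of parametric polytopes\<close>

text \<open>
  For \<open>\<beta>\<close> with exactly \<open>n\<close> elements, \<open>rows_of A \<beta>\<close> is the submatrix with rows \<open>A \<lambda>\<close>, \<open>\<lambda> \<in> \<beta>\<close>. The
  rows are enumerated by an arbitrary bijection, on which neither invertibility nor the point
  \<open>basic_point A b \<beta>\<close> depends.
\<close>

definition enum_of :: "'l set \<Rightarrow> 'n::finite \<Rightarrow> 'l" where
  "enum_of \<beta> = (SOME f. bij_betw f UNIV \<beta>)"

definition rows_of :: "('l \<Rightarrow> real^'n) \<Rightarrow> 'l set \<Rightarrow> real^'n^'n" where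
  "rows_of A \<beta> = (\<chi> i. A (enum_of \<beta> i))"

definition basic :: "'l set \<Rightarrow> ('l \<Rightarrow> real^'n) \<Rightarrow> 'l set \<Rightarrow> bool" where
  "basic \<Lambda> A \<beta> \<longleftrightarrow> \<beta> \<subseteq> \<Lambda> \<and> card \<beta> = CARD('n) \<and> invertible (rows_of A \<beta>)"

definition basic_point :: "('l \<Rightarrow> real^'n) \<Rightarrow> ('l \<Rightarrow> real) \<Rightarrow> 'l set \<Rightarrow> real^'n" where
  "basic_point A b \<beta> = matrix_inv (rows_of A \<beta>) *v (\<chi> i. b (enum_of \<beta> i))"

definition feasible_bases :: "'l set \<Rightarrow> ('l \<Rightarrow> real^'n) \<Rightarrow> ('l \<Rightarrow> real) \<Rightarrow> 'l set set" where
  "feasible_bases \<Lambda> A b = {\<beta>. basic \<Lambda> A \<beta> \<and> (\<forall>l\<in>\<Lambda>. A l \<bullet> basic_point A b \<beta> \<le> b l)}"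

definition active_labels :: "'l set \<Rightarrow> ('l \<Rightarrow> real^'n) \<Rightarrow> ('l \<Rightarrow> real) \<Rightarrow> 'l set \<Rightarrow> 'l set" where
  "active_labels \<Lambda> A b \<beta> = {l \<in> \<Lambda>. A l \<bullet> basic_point A b \<beta> = b l}"

definition polytope_type :: "'l set \<Rightarrow> ('l \<Rightarrow> real^'n) \<Rightarrow> ('l \<Rightarrow> real) \<Rightarrow> 'l set set" where
  "polytope_type \<Lambda> A b = active_labels \<Lambda> A b ` feasible_bases \<Lambda> A b"


section \<open>Cells\<close>

text \<open>
  A maximal cell \<open>(\<epsilon>, \<rho>)\<close> consists of the edges \<open>\<epsilon> i\<close> of the product and, for every edge \<open>e\<close>, a
  linear order \<open>\<rho> e\<close> of the coordinates on \<open>e\<close>; \<open>(i, j) \<in> \<rho> e\<close> means that \<open>x i \<le> x j\<close> on the cell.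
\<close>

type_synonym ('n, 'e) max_cell = "('n \<Rightarrow> 'e) \<times> ('e \<Rightarrow> ('n \<times> 'n) set)"

definition max_cells :: "('a, 'e) graph_complex \<Rightarrow> ('n, 'e) max_cell set" where
  "max_cells G = {(\<epsilon>, \<rho>). (\<forall>i. \<epsilon> i \<in> edges G) \<and> (\<forall>e\<in>edges G. linear_order_on {i. \<epsilon> i = e} (\<rho> e))}"

datatype 'n label =
    C1 'n | C2 'n
  | D1 'n 'n | D2 'n 'n | D3 'n 'n | D4 'n 'n
  | E1 'n 'n | E2 'n 'n | E3 'n 'n

definition cell_labels :: "('n::linorder, 'e) max_cell \<Rightarrow> 'n label set" where
  "cell_labels c = (case c of (\<epsilon>, \<rho>) \<Rightarrow>
     (\<Union>i. {C1 i, C2 i}) \<union>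
     (\<Union>(i, j)\<in>{(i, j). i < j \<and> \<epsilon> i \<noteq> \<epsilon> j}. {D1 i j, D2 i j, D3 i j, D4 i j}) \<union>
     (\<Union>(i, j)\<in>{(i, j). i \<noteq> j \<and> \<epsilon> i = \<epsilon> j \<and> (i, j) \<in> \<rho> (\<epsilon> i)}. {E1 i j, E2 i j, E3 i j}))"

fun label_row :: "'n label \<Rightarrow> real^'n" where
  "label_row (C1 i) = - axis i 1"
| "label_row (C2 i) = axis i 1"
| "label_row (D1 i j) = - axis i 1 - axis j 1"
| "label_row (D2 i j) = - axis i 1 + axis j 1"
| "label_row (D3 i j) = axis i 1 - axis j 1"
| "label_row (D4 i j) = axis i 1 + axis j 1"
| "label_row (E1 i j) = axis i 1 - axis j 1"
| "label_row (E2 i j) = axis i 1 - axis j 1"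
| "label_row (E3 i j) = - axis i 1 + axis j 1"

fun label_rhs ::
  "('a, 'e) graph_complex \<Rightarrow> ('n \<Rightarrow> 'e) \<Rightarrow> ('n \<Rightarrow> 'n \<Rightarrow> real) \<Rightarrow> 'n label \<Rightarrow> real" where
  "label_rhs G \<epsilon> r (C1 i) = 0"
| "label_rhs G \<epsilon> r (C2 i) = len G (\<epsilon> i)"
| "label_rhs G \<epsilon> r (D1 i j) = - r i j + gdist G (end0 G (\<epsilon> i)) (end0 G (\<epsilon> j))"
| "label_rhs G \<epsilon> r (D2 i j) = - r i j + gdist G (end0 G (\<epsilon> i)) (end1 G (\<epsilon> j)) + len G (\<epsilon> j)"
| "label_rhs G \<epsilon> r (D3 i j) = - r i j + gdist G (end1 G (\<epsilon> i)) (end0 G (\<epsilon> j)) + len G (\<epsilon> i)"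
| "label_rhs G \<epsilon> r (D4 i j) =
     - r i j + gdist G (end1 G (\<epsilon> i)) (end1 G (\<epsilon> j)) + len G (\<epsilon> i) + len G (\<epsilon> j)"
| "label_rhs G \<epsilon> r (E1 i j) = 0"
| "label_rhs G \<epsilon> r (E2 i j) = - r i j"
| "label_rhs G \<epsilon> r (E3 i j) = - r i j + gdist G (end0 G (\<epsilon> i)) (end1 G (\<epsilon> i)) + len G (\<epsilon> i)"

definition max_cell_type ::
  "('a, 'e) graph_complex \<Rightarrow> ('n::{finite,linorder}, 'e) max_cell \<Rightarrow> ('n \<Rightarrow> 'n \<Rightarrow> real) \<Rightarrow>
   'n label set set" where
  "max_cell_type G c r = polytope_type (cell_labels c) label_row (label_rhs G (fst c) r)"

text \<open>
  The faces of a maximal cell \<open>c\<close> are given by the sets \<open>\<tau>\<close> of labels from \<open>face_labels c\<close> that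
  are turned into equalities. The type of such a face is written in the labels of \<open>c\<close>: its
  vertices correspond exactly to the elements of the type of \<open>c\<close> containing \<open>\<tau>\<close>. A \<open>\<tau>\<close> whose
  equalities have no common solution in \<open>c\<close> yields the empty type for every \<open>r\<close>, so it need not be
  excluded.
\<close>

definition face_labels :: "('n::linorder, 'e) max_cell \<Rightarrow> 'n label set" where
  "face_labels c = cell_labels c \<inter> (range C1 \<union> range C2 \<union> {E1 i j |i j. True})"

definition face_type ::
  "('a, 'e) graph_complex \<Rightarrow> ('n::{finite,linorder}, 'e) max_cell \<Rightarrow> 'n label set \<Rightarrow>
   ('n \<Rightarrow> 'n \<Rightarrow> real) \<Rightarrow> 'n label set set" where
  "face_type G c \<tau> r = {v \<in> max_cell_type G c r. \<tau> \<subseteq> v}"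

definition param_equiv ::
  "('a, 'e) graph_complex \<Rightarrow> ('n::{finite,linorder} \<Rightarrow> 'n \<Rightarrow> real) \<Rightarrow> ('n \<Rightarrow> 'n \<Rightarrow> real) \<Rightarrow> bool"
where
  "param_equiv G r s \<longleftrightarrow>
     (\<forall>c\<in>max_cells G. \<forall>\<tau>. \<tau> \<subseteq> face_labels c \<longrightarrow> face_type G c \<tau> r = face_type G c \<tau> s)"

lemma param_equiv_iff_max_cells:
  "param_equiv G r s \<longleftrightarrow> (\<forall>c\<in>max_cells G. max_cell_type G c r = max_cell_type G c s)"
proof
  assume h: "param_equiv G r s"
  have "max_cell_type G c r = max_cell_type G c s" if "c \<in> max_cells G" for c
  proof -
    have "face_type G c {} r = face_type G c {} s"
      using h that unfolding param_equiv_def by blast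
    then show ?thesis
      by (simp add: face_type_def)
  qed
  then show "\<forall>c\<in>max_cells G. max_cell_type G c r = max_cell_type G c s" by blast
qed (simp add: param_equiv_def face_type_def)

end

theory Submission
  imports Defs
begin

text \<open>
  On a maximal cell \<open>c\<close> the space \<open>conf_space G r\<close> is the polytope cut out by the labelled
  inequalities (\<open>cell_polytope_iff\<close>, which rests on the fact that a path between two points of
  edges either stays on one edge or passes through end points). Only the right-hand sides depend
  on the parameters, so two parameters of the same type give polytopes with the same labelled
  vertices and the same faces, in different positions. The isotopy moves every vertex
  linearly from its position for \<open>r\<close> to its position for \<open>s\<close> and extends this to the
  polytopes by barycentric subdivision.

  The subdivision is encoded by weights on the vertices, a vertex being the set of labels that are
  active there. A weight function is admissible if each of its superlevel sets is the vertex set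
  of a face (\<open>quasiconcave\<close>); by layers, this means that it is a nonnegative combination of
  uniform distributions on an increasing chain of faces, i.e. a point of a simplex of the
  subdivision. The set \<open>face_weights T\<close> of these is compact and depends on the type \<open>T\<close>
  alone. Every point of the polytope has admissible weights, by projecting it from the barycentre of
  its smallest face to the boundary of that face (\<open>point_has_face_weights\<close>). They are unique,
  and remain so for the interpolated vertices, because the argument only looks at which slacks of
  the vertices vanish (\<open>weights_determined_by_slacks\<close>,
  \<open>interpolated_weights_determined\<close>).

  It remains to glue the cells. A point of the product that lies in two maximal cells lies in a
  common face of both, and there the two coordinate systems differ by a translation
  (\<open>face_in_neighbouring_cell\<close>). The labels of the two cells are unrelated, so the
  correspondence of the vertices on the common face has to be seen to be the same for \<open>r\<close> and
  for \<open>s\<close>. This is so since the cone of feasible directions at a vertex depends only on the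
  label set of the vertex, and it distinguishes the vertices (\<open>translated_vertex_label\<close>). As
  the correspondence also respects faces, admissible weights can be carried from one cell to the
  other (\<open>transport_face_weights\<close>). Hence two pairs of a cell and admissible weights that
  describe the same point at one time do so at all times, and compactness turns this into an
  isotopy (\<open>isotopic_in_compact_family\<close>).
\<close>

section \<open>Polytopes given by inequalities and their vertices\<close>

definition halfspaces :: "'l set \<Rightarrow> ('l \<Rightarrow> real^'n) \<Rightarrow> ('l \<Rightarrow> real) \<Rightarrow> (real^'n) set" where
  "halfspaces \<Lambda> A b = {x. \<forall>l\<in>\<Lambda>. A l \<bullet> x \<le> b l}"

definition tight :: "'l set \<Rightarrow> ('l \<Rightarrow> real^'n) \<Rightarrow> ('l \<Rightarrow> real) \<Rightarrow> real^'n \<Rightarrow> 'l set" where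
  "tight \<Lambda> A b x = {l\<in>\<Lambda>. A l \<bullet> x = b l}"

text \<open>
  Being a vertex is expressed by the rank of the active rows: no direction is orthogonal to all of
  them. Unlike \<open>feasible_bases\<close>, this mentions no choice of a basis.
\<close>

definition is_vertex :: "'l set \<Rightarrow> ('l \<Rightarrow> real^'n) \<Rightarrow> ('l \<Rightarrow> real) \<Rightarrow> real^'n \<Rightarrow> bool" where
  "is_vertex \<Lambda> A b x \<longleftrightarrow> x \<in> halfspaces \<Lambda> A b \<and> (\<forall>d. (\<forall>l\<in>tight \<Lambda> A b x. A l \<bullet> d = 0) \<longrightarrow> d = 0)"

lemma tight_subset: "tight \<Lambda> A b x \<subseteq> \<Lambda>"
  by (auto simp: tight_def)

lemma enum_of_bij:
  assumes "finite \<beta>" "card \<beta> = CARD('n::finite)"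
  shows "bij_betw (enum_of \<beta> :: 'n \<Rightarrow> 'l) UNIV \<beta>"
proof -
  have "\<exists>f::'n \<Rightarrow> 'l. bij_betw f UNIV \<beta>"
    using assms finite_same_card_bij[of "UNIV::'n set" \<beta>] by auto
  then show ?thesis
    unfolding enum_of_def by (rule someI_ex)
qed

lemma basic_point_rows:
  fixes A :: "'l \<Rightarrow> real^'n"
  assumes "basic \<Lambda> A \<beta>" "l \<in> \<beta>"
  shows "A l \<bullet> basic_point A b \<beta> = b l"
proof -
  have fin: "finite \<beta>" and c: "card \<beta> = CARD('n)" and inv: "invertible (rows_of A \<beta>)"
    using assms(1) card_ge_0_finite[of \<beta>] by (auto simp: basic_def)
  note bij = enum_of_bij[OF fin c]
  then obtain i :: 'n where i: "l = enum_of \<beta> i"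
    using assms(2) by (auto simp: bij_betw_def)
  have inverse: "rows_of A \<beta> ** matrix_inv (rows_of A \<beta>) = mat 1"
    using someI_ex[OF inv[unfolded invertible_def]] by (simp add: matrix_inv_def)
  have "rows_of A \<beta> *v basic_point A b \<beta> = (\<chi> i. b (enum_of \<beta> i))"
    unfolding basic_point_def matrix_vector_mul_assoc inverse by simp
  then have "(rows_of A \<beta> *v basic_point A b \<beta>) $ i = b l"
    by (simp add: i)
  moreover have "(rows_of A \<beta> *v basic_point A b \<beta>) $ i = A l \<bullet> basic_point A b \<beta>"
    by (simp add: rows_of_def matrix_vector_mul_component i)
  ultimately show ?thesis by simp
qed

lemma basic_rows_separate:
  fixes A :: "'l \<Rightarrow> real^'n"
  assumes "basic \<Lambda> A \<beta>" "\<forall>l\<in>\<beta>. A l \<bullet> d = 0"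
  shows "d = 0"
proof -
  have fin: "finite \<beta>" and c: "card \<beta> = CARD('n)" and inv: "invertible (rows_of A \<beta>)"
    using assms(1) card_ge_0_finite[of \<beta>] by (auto simp: basic_def)
  note bij = enum_of_bij[OF fin c]
  then have "enum_of \<beta> (i::'n) \<in> \<beta>" for i by (auto simp: bij_betw_def)
  then have "rows_of A \<beta> *v d = 0"
    using assms(2) by (simp add: vec_eq_iff matrix_vector_mul_component rows_of_def)
  then show ?thesis
    using inv by (metis invertible_left_inverse matrix_left_invertible_ker)
qed

lemma basis_among_rows:
  fixes A :: "'l \<Rightarrow> real^'n"
  assumes "finite \<Lambda>" "\<sigma> \<subseteq> \<Lambda>" and sep: "\<And>d. (\<forall>l\<in>\<sigma>. A l \<bullet> d = 0) \<Longrightarrow> d = 0"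
  shows "\<exists>\<beta>\<subseteq>\<sigma>. basic \<Lambda> A \<beta>"
proof -
  have "span (A ` \<sigma>) = UNIV"
  proof (rule ccontr)
    assume "span (A ` \<sigma>) \<noteq> UNIV"
    then have "span (A ` \<sigma>) \<subset> UNIV" by auto
    then obtain a where "a \<noteq> 0" "\<forall>x\<in>span (A ` \<sigma>). a \<bullet> x = 0"
      using span_not_univ_subset_hyperplane[of "A ` \<sigma>"] by blast
    moreover have "A l \<bullet> a = 0" if "l \<in> \<sigma>" for l
      using \<open>\<forall>x\<in>span (A ` \<sigma>). a \<bullet> x = 0\<close> that
      by (metis inner_commute imageI span_base)
    ultimately show False using sep by blast
  qed
  moreover obtain B where B: "B \<subseteq> A ` \<sigma>" "independent B" "A ` \<sigma> \<subseteq> span B"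
    using maximal_independent_subset[of "A ` \<sigma>"] by metis
  ultimately have spanB: "span B = UNIV"
    by (metis span_mono span_span top.extremum_uniqueI)
  then have cardB: "card B = CARD('n)"
    using B(2) basis_card_eq_dim[of B UNIV] by (simp add: independent_imp_finite)
  obtain \<beta> where \<beta>: "\<beta> \<subseteq> \<sigma>" "inj_on A \<beta>" "B = A ` \<beta>"
    using B(1) by (metis subset_image_inj)
  have c\<beta>: "card \<beta> = CARD('n)" using \<beta> cardB by (simp add: card_image)
  have fin: "finite \<beta>" by (rule finite_subset[OF order_trans[OF \<beta>(1) assms(2)] assms(1)])
  note bij = enum_of_bij[OF fin c\<beta>]
  have "rows (rows_of A \<beta>) = A ` (enum_of \<beta> ` (UNIV :: 'n set))"
    by (auto simp: rows_def row_def rows_of_def)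
  also have "\<dots> = B" using bij \<beta>(3) by (simp add: bij_betw_def)
  finally have "invertible (rows_of A \<beta>)"
    using spanB by (simp add: invertible_left_inverse matrix_left_invertible_span_rows)
  then have "basic \<Lambda> A \<beta>"
    unfolding basic_def using order_trans[OF \<beta>(1) assms(2)] c\<beta> by simp
  then show ?thesis using \<beta>(1) by blast
qed

text \<open>
  A basic feasible point is a vertex, and conversely the active rows at a vertex span the space and
  so contain a basis that determines it. Everything below uses types in this form only.
\<close>

lemma polytope_type_eq_tight_sets:
  fixes A :: "'l \<Rightarrow> real^'n"
  assumes "finite \<Lambda>"
  shows "polytope_type \<Lambda> A b = tight \<Lambda> A b ` {x. is_vertex \<Lambda> A b x}"
proof (intro set_eqI iffI)
  fix v assume "v \<in> polytope_type \<Lambda> A b"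
  then obtain \<beta> where \<beta>: "basic \<Lambda> A \<beta>" "\<forall>l\<in>\<Lambda>. A l \<bullet> basic_point A b \<beta> \<le> b l"
    and v: "v = active_labels \<Lambda> A b \<beta>"
    by (auto simp: polytope_type_def feasible_bases_def)
  let ?x = "basic_point A b \<beta>"
  have "\<beta> \<subseteq> tight \<Lambda> A b ?x"
    using \<beta>(1) basic_point_rows[OF \<beta>(1)] by (auto simp: tight_def basic_def)
  then have "is_vertex \<Lambda> A b ?x"
    using \<beta> basic_rows_separate[OF \<beta>(1)]
    unfolding is_vertex_def halfspaces_def by blast
  then show "v \<in> tight \<Lambda> A b ` {x. is_vertex \<Lambda> A b x}"
    by (auto simp: v active_labels_def tight_def)
next
  fix v assume "v \<in> tight \<Lambda> A b ` {x. is_vertex \<Lambda> A b x}"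
  then obtain x where x: "is_vertex \<Lambda> A b x" "v = tight \<Lambda> A b x" by auto
  obtain \<beta> where \<beta>: "\<beta> \<subseteq> v" "basic \<Lambda> A \<beta>"
    using basis_among_rows[OF assms tight_subset, of A b x A] x unfolding is_vertex_def by blast
  have "\<forall>l\<in>\<beta>. A l \<bullet> (basic_point A b \<beta> - x) = 0"
    using \<beta> x(2) basic_point_rows[OF \<beta>(2)] by (auto simp: inner_diff_right tight_def)
  from basic_rows_separate[OF \<beta>(2) this] have "basic_point A b \<beta> = x" by simp
  then show "v \<in> polytope_type \<Lambda> A b"
    using x \<beta>(2) unfolding polytope_type_def
    by (auto simp: feasible_bases_def active_labels_def tight_def is_vertex_def halfspaces_def intro!: image_eqI[of _ _ \<beta>])
qed

definition vertex_of :: "'l set \<Rightarrow> ('l \<Rightarrow> real^'n) \<Rightarrow> ('l \<Rightarrow> real) \<Rightarrow> 'l set \<Rightarrow> real^'n" where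
  "vertex_of \<Lambda> A b v = (SOME x. is_vertex \<Lambda> A b x \<and> tight \<Lambda> A b x = v)"

lemma vertex_of:
  assumes "finite \<Lambda>" "v \<in> polytope_type \<Lambda> A b"
  shows "is_vertex \<Lambda> A b (vertex_of \<Lambda> A b v)" "tight \<Lambda> A b (vertex_of \<Lambda> A b v) = v"
proof -
  have "\<exists>x. is_vertex \<Lambda> A b x \<and> tight \<Lambda> A b x = v"
    using assms by (auto simp: polytope_type_eq_tight_sets)
  from someI_ex[OF this] show "is_vertex \<Lambda> A b (vertex_of \<Lambda> A b v)" "tight \<Lambda> A b (vertex_of \<Lambda> A b v) = v"
    by (auto simp: vertex_of_def)
qed

lemma vertex_determined:
  assumes "is_vertex \<Lambda> A b x" "tight \<Lambda> A b x \<subseteq> tight \<Lambda> A b y"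
  shows "x = y"
proof -
  have "\<forall>l\<in>tight \<Lambda> A b x. A l \<bullet> (y - x) = 0"
    using assms(2) by (auto simp: tight_def inner_diff_right)
  then show ?thesis using assms(1) by (auto simp: is_vertex_def)
qed

lemma vertex_of_tight:
  assumes "finite \<Lambda>" "is_vertex \<Lambda> A b x"
  shows "tight \<Lambda> A b x \<in> polytope_type \<Lambda> A b" "vertex_of \<Lambda> A b (tight \<Lambda> A b x) = x"
proof -
  show 1: "tight \<Lambda> A b x \<in> polytope_type \<Lambda> A b"
    using assms by (auto simp: polytope_type_eq_tight_sets)
  show "vertex_of \<Lambda> A b (tight \<Lambda> A b x) = x"
    using vertex_determined[OF assms(2)] vertex_of(2)[OF assms(1) 1] by (metis subset_refl)
qed

lemma polytope_type_subset:
  assumes "v \<in> polytope_type \<Lambda> A b" shows "v \<subseteq> \<Lambda>"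
  using assms by (auto simp: polytope_type_def active_labels_def)

lemma finite_polytope_type: "finite \<Lambda> \<Longrightarrow> finite (polytope_type \<Lambda> A b)"
  by (rule finite_subset[of _ "Pow \<Lambda>"]) (auto dest: polytope_type_subset)

text \<open>
  The feasible directions at a point depend on the active labels only; the finitely many other
  inequalities are strict and survive a small step.
\<close>

lemma small_step_feasible:
  assumes "finite \<Lambda>" "x \<in> halfspaces \<Lambda> A b" "\<forall>l\<in>tight \<Lambda> A b x. A l \<bullet> d \<le> 0"
  shows "\<exists>\<epsilon>>0. x + \<epsilon> *\<^sub>R d \<in> halfspaces \<Lambda> A b"
proof -
  have "\<forall>\<^sub>F \<epsilon> in at_right 0. A l \<bullet> (x + \<epsilon> *\<^sub>R d) \<le> b l" if l: "l \<in> \<Lambda>" for l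
  proof (cases "A l \<bullet> x = b l")
    case True
    then have "A l \<bullet> d \<le> 0" using assms(3) l by (auto simp: tight_def)
    then show ?thesis
      using True eventually_at_right_less[of "0::real"]
      by (auto elim!: eventually_mono simp: inner_add_right mult_nonneg_nonpos)
  next
    case False
    then have "A l \<bullet> (x + 0 *\<^sub>R d) < b l" using assms(2) l by (force simp: halfspaces_def)
    moreover have "((\<lambda>\<epsilon>. A l \<bullet> (x + \<epsilon> *\<^sub>R d)) \<longlongrightarrow> A l \<bullet> (x + 0 *\<^sub>R d)) (at_right 0)"
      by (intro tendsto_intros)
    ultimately have "\<forall>\<^sub>F \<epsilon> in at_right 0. A l \<bullet> (x + \<epsilon> *\<^sub>R d) < b l"
      by (rule order_tendstoD(2)[rotated])
    then show ?thesis by (auto elim: eventually_mono)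
  qed
  then have "\<forall>\<^sub>F \<epsilon> in at_right 0. \<forall>l\<in>\<Lambda>. A l \<bullet> (x + \<epsilon> *\<^sub>R d) \<le> b l"
    using assms(1) by (simp add: eventually_ball_finite_distrib)
  then have "\<forall>\<^sub>F \<epsilon> in at_right 0. 0 < \<epsilon> \<and> x + \<epsilon> *\<^sub>R d \<in> halfspaces \<Lambda> A b"
    using eventually_at_right_less[of "0::real"]
    by eventually_elim (auto simp: halfspaces_def)
  then show ?thesis
    using eventually_happens'[OF trivial_limit_at_right_real] by blast
qed

lemma no_recession_direction:
  assumes "bounded (halfspaces \<Lambda> A b)" "y \<in> halfspaces \<Lambda> A b" "\<forall>l\<in>\<Lambda>. A l \<bullet> d \<le> 0"
  shows "d = 0"
proof (rule ccontr)
  assume d: "d \<noteq> 0"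
  obtain B where B: "\<And>z. z \<in> halfspaces \<Lambda> A b \<Longrightarrow> norm z \<le> B"
    using assms(1) by (auto simp: bounded_iff)
  have mem: "y + k *\<^sub>R d \<in> halfspaces \<Lambda> A b" if "k \<ge> 0" for k
    using assms(2,3) that
    by (auto simp: halfspaces_def inner_add_right intro: order_trans[OF add_mono[OF _ mult_nonneg_nonpos]])
  define k where "k = (B + norm y + 1) / norm d"
  have "B \<ge> 0" using B[OF assms(2)] norm_ge_zero[of y] by linarith
  then have k: "k \<ge> 0" by (simp add: k_def)
  have "norm (k *\<^sub>R d) \<le> norm (y + k *\<^sub>R d) + norm y"
    by (metis add_diff_cancel_left' norm_triangle_ineq4)
  also have "\<dots> \<le> B + norm y" using B[OF mem[OF k]] by simp
  finally show False using d k by (simp add: k_def)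
qed

text \<open>
  The smallest face containing \<open>x\<close> has vertices, and it is the convex hull of them by the
  Krein-Milman theorem. So an inequality that is strict at \<open>x\<close> is strict at one of the
  vertices. Stated as an implication in \<open>l\<close>, this also yields a vertex when every label is
  active at \<open>x\<close>.
\<close>

lemma face_vertex_avoiding:
  fixes A :: "'l \<Rightarrow> real^'n"
  assumes fin: "finite \<Lambda>" and comp: "compact (halfspaces \<Lambda> A b)" and x: "x \<in> halfspaces \<Lambda> A b"
  shows "\<exists>v\<in>polytope_type \<Lambda> A b. tight \<Lambda> A b x \<subseteq> v \<and> (l \<in> \<Lambda> - tight \<Lambda> A b x \<longrightarrow> l \<notin> v)"
proof -
  define F where "F = {y \<in> halfspaces \<Lambda> A b. tight \<Lambda> A b x \<subseteq> tight \<Lambda> A b y}"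
  have F: "F = halfspaces \<Lambda> A b \<inter> (\<Inter>l\<in>tight \<Lambda> A b x. {y. A l \<bullet> y = b l})"
    by (auto simp: F_def tight_def)
  have "convex (halfspaces \<Lambda> A b)"
  proof -
    have "halfspaces \<Lambda> A b = (\<Inter>l\<in>\<Lambda>. {y. A l \<bullet> y \<le> b l})" by (auto simp: halfspaces_def)
    then show ?thesis by (auto intro!: convex_INT convex_halfspace_le)
  qed
  then have "convex F" "compact F"
    unfolding F using comp
    by (auto intro!: convex_Int convex_INT convex_hyperplane compact_Int_closed closed_INT closed_hyperplane)
  then have hull: "F = convex hull {y. y extreme_point_of F}"
    by (rule Krein_Milman_Minkowski[rotated])
  have ext: "is_vertex \<Lambda> A b y" if y: "y extreme_point_of F" for y
    unfolding is_vertex_def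
  proof (intro conjI allI impI)
    have yF: "y \<in> F" using y by (simp add: extreme_point_of_def)
    then show "y \<in> halfspaces \<Lambda> A b" by (simp add: F_def)
    fix d assume d: "\<forall>l\<in>tight \<Lambda> A b y. A l \<bullet> d = 0"
    obtain \<epsilon> where \<epsilon>: "\<epsilon> > 0" "y + \<epsilon> *\<^sub>R d \<in> halfspaces \<Lambda> A b"
      using small_step_feasible[OF fin, of y A b d] yF d by (auto simp: F_def)
    obtain \<epsilon>' where \<epsilon>': "\<epsilon>' > 0" "y + \<epsilon>' *\<^sub>R (- d) \<in> halfspaces \<Lambda> A b"
      using small_step_feasible[OF fin, of y A b "- d"] yF d by (auto simp: F_def)
    have "y + \<epsilon> *\<^sub>R d \<in> F" "y + \<epsilon>' *\<^sub>R (- d) \<in> F"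
      using \<epsilon> \<epsilon>' d yF by (auto simp: F_def tight_def subset_iff inner_add_right inner_diff_right)
    moreover have "y \<in> open_segment (y + \<epsilon> *\<^sub>R d) (y + \<epsilon>' *\<^sub>R (- d))" if "d \<noteq> 0"
    proof -
      have "y = (1 - \<epsilon> / (\<epsilon> + \<epsilon>')) *\<^sub>R (y + \<epsilon> *\<^sub>R d) + (\<epsilon> / (\<epsilon> + \<epsilon>')) *\<^sub>R (y + \<epsilon>' *\<^sub>R (- d))"
      proof -
        have "(1 - \<epsilon> / (\<epsilon> + \<epsilon>')) * \<epsilon> = \<epsilon> / (\<epsilon> + \<epsilon>') * \<epsilon>'"
          using \<epsilon>(1) \<epsilon>'(1) by (simp add: field_simps)
        then have "(1 - \<epsilon> / (\<epsilon> + \<epsilon>')) *\<^sub>R (\<epsilon> *\<^sub>R d) - (\<epsilon> / (\<epsilon> + \<epsilon>')) *\<^sub>R (\<epsilon>' *\<^sub>R d) = 0"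
          by (simp only: scaleR_scaleR) simp
        moreover have "(1 - c) *\<^sub>R (y + p) + c *\<^sub>R (y + - q) = y + ((1 - c) *\<^sub>R p - c *\<^sub>R q)"
          for c and p q :: "real^'n"
          by (simp add: algebra_simps)
        ultimately show ?thesis by (simp only: scaleR_minus_right add_0_right)
      qed
      moreover have "0 < \<epsilon> / (\<epsilon> + \<epsilon>')" "\<epsilon> / (\<epsilon> + \<epsilon>') < 1" using \<epsilon>(1) \<epsilon>'(1) by auto
      moreover have "y + \<epsilon> *\<^sub>R d \<noteq> y + \<epsilon>' *\<^sub>R (- d)"
      proof
        assume "y + \<epsilon> *\<^sub>R d = y + \<epsilon>' *\<^sub>R (- d)"
        then have "(\<epsilon> + \<epsilon>') *\<^sub>R d = 0" by (simp add: scaleR_left_distrib)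
        then show False using \<epsilon>(1) \<epsilon>'(1) that by simp
      qed
      ultimately show ?thesis unfolding in_segment by blast
    qed
    ultimately show "d = 0" using y by (auto simp: extreme_point_of_def)
  qed
  have xF: "x \<in> F" using x by (simp add: F_def)
  have "\<exists>y. y extreme_point_of F \<and> (l \<in> \<Lambda> - tight \<Lambda> A b x \<longrightarrow> A l \<bullet> y \<noteq> b l)"
  proof (rule ccontr)
    assume "\<not> ?thesis"
    then have all: "\<And>y. y extreme_point_of F \<Longrightarrow> l \<in> \<Lambda> - tight \<Lambda> A b x \<and> A l \<bullet> y = b l" by blast
    then have "convex hull {y. y extreme_point_of F} \<subseteq> {y. A l \<bullet> y = b l}"
      by (intro hull_minimal) (auto simp: convex_hyperplane)
    then have "A l \<bullet> x = b l" using xF hull by auto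
    moreover have "l \<in> \<Lambda> - tight \<Lambda> A b x"
      using all xF hull by (metis convex_hull_empty emptyE equals0I mem_Collect_eq)
    ultimately show False by (auto simp: tight_def)
  qed
  then obtain y where y: "y extreme_point_of F" "l \<in> \<Lambda> - tight \<Lambda> A b x \<longrightarrow> A l \<bullet> y \<noteq> b l" by blast
  then have "y \<in> F" by (simp add: extreme_point_of_def)
  then show ?thesis
    using y vertex_of_tight(1)[OF fin ext[OF y(1)]]
    by (intro bexI[of _ "tight \<Lambda> A b y"]) (auto simp: F_def tight_def)
qed

section \<open>Barycentric subdivision by weights on the vertices\<close>

text \<open>
  The elements of \<open>T\<close> are the sets of labels active at the vertices of a polytope. The
  labels common to all vertices in \<open>S\<close> are those of the smallest face containing \<open>S\<close>,
  so that \<open>\<Inter>S \<subseteq> v\<close> says that \<open>v\<close> is a vertex of that face. The condition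
  is therefore that for all \<open>c > 0\<close> the set of vertices of weight at least \<open>c\<close> is the
  vertex set of a face, if it is not empty. This form makes it obvious that it is a closed
  condition on \<open>w\<close>.
\<close>

definition quasiconcave :: "'l set set \<Rightarrow> ('l set \<Rightarrow> real) \<Rightarrow> bool" where
  "quasiconcave T w \<longleftrightarrow> (\<forall>v. 0 \<le> w v) \<and> (\<forall>v. v \<notin> T \<longrightarrow> w v = 0) \<and>
     (\<forall>S v. S \<subseteq> T \<and> S \<noteq> {} \<and> v \<in> T \<and> \<Inter>S \<subseteq> v \<longrightarrow> (\<exists>u\<in>S. w u \<le> w v))"

text \<open>
  A copy of the barycentric subdivision of the polytope inside the simplex spanned by its vertices.
\<close>

definition face_weights :: "'l set set \<Rightarrow> ('l set \<Rightarrow> real) set" where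
  "face_weights T = {w. quasiconcave T w \<and> sum w T = 1}"

lemma quasiconcave_nonneg: "quasiconcave T w \<Longrightarrow> 0 \<le> w v"
  by (simp add: quasiconcave_def)

lemma quasiconcave_support: "quasiconcave T w \<Longrightarrow> w v \<noteq> 0 \<Longrightarrow> v \<in> T"
  unfolding quasiconcave_def by metis

text \<open>
  Removing the bottom layer of the weights, and adding a layer at the bottom, are the two steps of
  the inductions on the chain of faces.
\<close>

lemma quasiconcave_subtract:
  assumes q: "quasiconcave T w" and m: "\<And>v. w v \<noteq> 0 \<Longrightarrow> m \<le> w v"
  shows "quasiconcave T (\<lambda>v. w v - m * indicator {v. w v \<noteq> 0} v)"
  unfolding quasiconcave_def
proof (intro conjI allI impI)
  have nn: "\<And>v. 0 \<le> w v" using q by (simp add: quasiconcave_def)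
  show "0 \<le> w v - m * indicator {v. w v \<noteq> 0} v" for v
    using m[of v] by (cases "w v = 0") auto
  show "w v - m * indicator {v. w v \<noteq> 0} v = 0" if "v \<notin> T" for v
    using that q by (auto simp: quasiconcave_def)
  fix S v assume "S \<subseteq> T \<and> S \<noteq> {} \<and> v \<in> T \<and> \<Inter>S \<subseteq> v"
  then obtain u where u: "u \<in> S" "w u \<le> w v" using q unfolding quasiconcave_def by blast
  show "\<exists>u\<in>S. w u - m * indicator {v. w v \<noteq> 0} u \<le> w v - m * indicator {v. w v \<noteq> 0} v"
    using u m[of v] nn[of u] by (intro bexI[of _ u]) (auto simp: indicator_def)
qed

lemma quasiconcave_add_face:
  assumes q: "quasiconcave T w" and supp: "\<And>v. w v \<noteq> 0 \<Longrightarrow> \<sigma> \<subseteq> v" and c: "0 \<le> c"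
  shows "quasiconcave T (\<lambda>v. w v + c * indicator {v\<in>T. \<sigma> \<subseteq> v} v)"
  unfolding quasiconcave_def
proof (intro conjI allI impI)
  have nn: "\<And>v. 0 \<le> w v" using q by (simp add: quasiconcave_def)
  show "0 \<le> w v + c * indicator {v\<in>T. \<sigma> \<subseteq> v} v" for v
    using nn[of v] c by simp
  show "w v + c * indicator {v\<in>T. \<sigma> \<subseteq> v} v = 0" if "v \<notin> T" for v
    using that q by (auto simp: quasiconcave_def)
  fix S v assume S: "S \<subseteq> T \<and> S \<noteq> {} \<and> v \<in> T \<and> \<Inter>S \<subseteq> v"
  show "\<exists>u\<in>S. w u + c * indicator {v\<in>T. \<sigma> \<subseteq> v} u \<le> w v + c * indicator {v\<in>T. \<sigma> \<subseteq> v} v"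
  proof (cases "\<sigma> \<subseteq> v")
    case True
    obtain u where u: "u \<in> S" "w u \<le> w v" using q S unfolding quasiconcave_def by blast
    then show ?thesis using True S c by (intro bexI[of _ u]) (auto simp: indicator_def)
  next
    case False
    then obtain u where u: "u \<in> S" "\<not> \<sigma> \<subseteq> u" using S by blast
    then have "w u = 0" using supp by blast
    then show ?thesis using u False nn[of v] by (intro bexI[of _ u]) auto
  qed
qed

text \<open>
  A label is active at the weighted combination exactly if it is active at every vertex of positive
  weight, and the support is the full vertex set of a face. Here \<open>g l v\<close> is the slack of the
  inequality \<open>l\<close> at the vertex \<open>v\<close>, of which only the zeros matter.
\<close>

lemma support_determined_by_zero_slacks:
  assumes fin: "finite T" and T: "T \<subseteq> Pow \<Lambda>"
    and nn: "\<And>l v. l \<in> \<Lambda> \<Longrightarrow> v \<in> T \<Longrightarrow> 0 \<le> g l v"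
    and zero: "\<And>l v. l \<in> \<Lambda> \<Longrightarrow> v \<in> T \<Longrightarrow> g l v = 0 \<longleftrightarrow> l \<in> v"
    and q: "quasiconcave T w" and ne: "w v0 \<noteq> 0"
  shows "{v. w v \<noteq> 0} = {v\<in>T. {l\<in>\<Lambda>. (\<Sum>u\<in>T. w u * g l u) = 0} \<subseteq> v}"
proof -
  have w: "\<And>v. 0 \<le> w v" "\<And>v. w v \<noteq> 0 \<Longrightarrow> v \<in> T"
    using q by (auto intro: quasiconcave_nonneg quasiconcave_support)
  have sum0: "(\<Sum>u\<in>T. w u * g l u) = 0 \<longleftrightarrow> (\<forall>u. w u \<noteq> 0 \<longrightarrow> l \<in> u)" if "l \<in> \<Lambda>" for l
  proof -
    have "(\<Sum>u\<in>T. w u * g l u) = 0 \<longleftrightarrow> (\<forall>u\<in>T. w u * g l u = 0)"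
      using fin nn[OF that] w(1) by (intro sum_nonneg_eq_0_iff) auto
    then show ?thesis using zero[OF that] w(2) by auto
  qed
  have eq: "{l\<in>\<Lambda>. (\<Sum>u\<in>T. w u * g l u) = 0} = \<Inter>{v. w v \<noteq> 0}"
    using sum0 w(2)[OF ne] ne T by auto
  show ?thesis unfolding eq
  proof (intro set_eqI iffI)
    fix v assume "v \<in> {v\<in>T. \<Inter>{v. w v \<noteq> 0} \<subseteq> v}"
    moreover have "{v. w v \<noteq> 0} \<subseteq> T" "{v. w v \<noteq> 0} \<noteq> {}" using w(2) ne by auto
    ultimately obtain u where "w u \<noteq> 0" "w u \<le> w v"
      using q unfolding quasiconcave_def by blast
    then show "v \<in> {v. w v \<noteq> 0}" using w(1)[of u] by auto
  qed (use w(2) in auto)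
qed

text \<open>
  Both weight functions have the same support, which is read off from the vanishing slacks. Subtract
  the smallest weight occurring in either from both on this support; one of the supports shrinks,
  and the remaining weights still have equal slacks.
\<close>

lemma weights_determined_by_slacks:
  assumes fin: "finite T" and T: "T \<subseteq> Pow \<Lambda>"
    and nn: "\<And>l v. l \<in> \<Lambda> \<Longrightarrow> v \<in> T \<Longrightarrow> 0 \<le> g l v"
    and zero: "\<And>l v. l \<in> \<Lambda> \<Longrightarrow> v \<in> T \<Longrightarrow> g l v = 0 \<longleftrightarrow> l \<in> v"
  shows "\<lbrakk>quasiconcave T w; quasiconcave T w'; sum w T = sum w' T;
     \<And>l. l \<in> \<Lambda> \<Longrightarrow> (\<Sum>v\<in>T. w v * g l v) = (\<Sum>v\<in>T. w' v * g l v)\<rbrakk> \<Longrightarrow> w = w'"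
proof (induction "card {v. w v \<noteq> 0} + card {v. w' v \<noteq> 0}" arbitrary: w w' rule: less_induct)
  case (less w w')
  have w: "\<And>v. 0 \<le> w v" "\<And>v. w v \<noteq> 0 \<Longrightarrow> v \<in> T"
    and w': "\<And>v. 0 \<le> w' v" "\<And>v. w' v \<noteq> 0 \<Longrightarrow> v \<in> T"
    using less.prems(1,2) by (auto intro: quasiconcave_nonneg quasiconcave_support)
  have total: "(\<forall>v. w v = 0) \<longleftrightarrow> (\<forall>v. w' v = 0)"
  proof -
    have "sum w T = 0 \<longleftrightarrow> (\<forall>v\<in>T. w v = 0)" "sum w' T = 0 \<longleftrightarrow> (\<forall>v\<in>T. w' v = 0)"
      by (rule sum_nonneg_eq_0_iff[OF fin w(1)], rule sum_nonneg_eq_0_iff[OF fin w'(1)])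
    then show ?thesis using less.prems(3) w(2) w'(2) by auto
  qed
  show ?case
  proof (cases "\<forall>v. w v = 0")
    case True
    then show ?thesis using total by auto
  next
    case False
    then obtain v0 v1 where ne: "w v0 \<noteq> 0" "w' v1 \<noteq> 0" using total by blast
    define V where "V = {v. w v \<noteq> 0}"
    have "{l\<in>\<Lambda>. (\<Sum>v\<in>T. w v * g l v) = 0} = {l\<in>\<Lambda>. (\<Sum>v\<in>T. w' v * g l v) = 0}"
      using less.prems(4) by auto
    moreover note support_determined_by_zero_slacks[where g = g, OF fin T nn zero less.prems(1) ne(1)]
      support_determined_by_zero_slacks[where g = g, OF fin T nn zero less.prems(2) ne(2)]
    ultimately have V': "{v. w' v \<noteq> 0} = V" by (simp add: V_def)
    have finV: "finite V" using w(2) fin by (auto simp: V_def intro: finite_subset[of _ T])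
    have neV: "V \<noteq> {}" using ne by (auto simp: V_def)
    define m where "m = Min (w ` V \<union> w' ` V)"
    have "m \<in> w ` V \<union> w' ` V" unfolding m_def using finV neV by (intro Min_in) auto
    then obtain u where u: "u \<in> V" "m = w u \<or> m = w' u" by auto
    have le: "m \<le> w v" "m \<le> w' v" if "v \<in> V" for v
      unfolding m_def using finV that by (auto intro!: Min_le)
    define z where "z = (\<lambda>v. w v - m * indicator V v)"
    define z' where "z' = (\<lambda>v. w' v - m * indicator V v)"
    have q: "quasiconcave T z" "quasiconcave T z'"
      using quasiconcave_subtract[OF less.prems(1), of m] quasiconcave_subtract[OF less.prems(2), of m]
        le V' by (auto simp: z_def z'_def V_def)
    have out: "w v = 0" "w' v = 0" if "v \<notin> V" for v using that V' by (auto simp: V_def)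
    have sub: "{v. z v \<noteq> 0} \<subseteq> V" "{v. z' v \<noteq> 0} \<subseteq> V"
      using out by (auto simp: z_def z'_def indicator_def split: if_splits)
    have "z u = 0 \<or> z' u = 0" using u by (auto simp: z_def z'_def)
    then have "{v. z v \<noteq> 0} \<subset> V \<or> {v. z' v \<noteq> 0} \<subset> V" using sub u(1) by auto
    then have smaller: "card {v. z v \<noteq> 0} + card {v. z' v \<noteq> 0} < card {v. w v \<noteq> 0} + card {v. w' v \<noteq> 0}"
      unfolding V' V_def[symmetric]
      using psubset_card_mono[OF finV] card_mono[OF finV] sub
      by (meson add_le_less_mono add_less_le_mono)
    have "z = z'"
    proof (rule less.hyps[OF smaller q])
      show "sum z T = sum z' T"
        using less.prems(3) by (simp add: z_def z'_def sum_subtractf)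
      show "(\<Sum>v\<in>T. z v * g l v) = (\<Sum>v\<in>T. z' v * g l v)" if "l \<in> \<Lambda>" for l
        using less.prems(4)[OF that] by (simp add: z_def z'_def left_diff_distrib sum_subtractf)
    qed
    then show ?thesis by (auto simp: z_def z'_def fun_eq_iff)
  qed
qed

lemma inner_weighted_sum:
  assumes "sum w T = (1::real)"
  shows "b l - a \<bullet> (\<Sum>v\<in>T. w v *\<^sub>R p v) = (\<Sum>v\<in>T. w v * (b l - a \<bullet> p v))"
  using assms by (simp add: inner_sum_right right_diff_distrib sum_subtractf flip: sum_distrib_right)

lemma vertex_slack:
  assumes "finite \<Lambda>" "v \<in> polytope_type \<Lambda> A b" "l \<in> \<Lambda>"
  shows "0 \<le> b l - A l \<bullet> vertex_of \<Lambda> A b v" "b l - A l \<bullet> vertex_of \<Lambda> A b v = 0 \<longleftrightarrow> l \<in> v"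
proof -
  have "l \<in> tight \<Lambda> A b (vertex_of \<Lambda> A b v) \<longleftrightarrow> l \<in> v"
    using vertex_of(2)[OF assms(1,2)] by simp
  then show "b l - A l \<bullet> vertex_of \<Lambda> A b v = 0 \<longleftrightarrow> l \<in> v"
    using assms(3) by (auto simp: tight_def)
  show "0 \<le> b l - A l \<bullet> vertex_of \<Lambda> A b v"
    using vertex_of(1)[OF assms(1,2)] assms(3) by (auto simp: is_vertex_def halfspaces_def)
qed

lemma tight_weighted_sum:
  assumes fin: "finite \<Lambda>" and S: "S \<subseteq> polytope_type \<Lambda> A b" and w: "\<And>v. v \<in> S \<Longrightarrow> 0 \<le> w v" "sum w S = 1"
  shows "(\<Sum>v\<in>S. w v *\<^sub>R vertex_of \<Lambda> A b v) \<in> halfspaces \<Lambda> A b"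
    and "l \<in> tight \<Lambda> A b (\<Sum>v\<in>S. w v *\<^sub>R vertex_of \<Lambda> A b v) \<longleftrightarrow> l \<in> \<Lambda> \<and> (\<forall>v\<in>S. w v \<noteq> 0 \<longrightarrow> l \<in> v)"
proof -
  let ?x = "\<Sum>v\<in>S. w v *\<^sub>R vertex_of \<Lambda> A b v"
  have slack: "0 \<le> w v * (b l - A l \<bullet> vertex_of \<Lambda> A b v)" if "l \<in> \<Lambda>" "v \<in> S" for l v
    using vertex_slack(1)[OF fin subsetD[OF S that(2)] that(1)] w(1)[OF that(2)]
    by (rule mult_nonneg_nonneg[rotated])
  have "0 \<le> b l - A l \<bullet> ?x" if "l \<in> \<Lambda>" for l
    unfolding inner_weighted_sum[OF w(2)] by (rule sum_nonneg) (rule slack[OF that])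
  then show "?x \<in> halfspaces \<Lambda> A b" by (simp add: halfspaces_def)
  have finS: "finite S" using finite_subset[OF S finite_polytope_type[OF fin]] .
  have "b l - A l \<bullet> ?x = 0 \<longleftrightarrow> (\<forall>v\<in>S. w v \<noteq> 0 \<longrightarrow> l \<in> v)" if "l \<in> \<Lambda>"
  proof -
    have "b l - A l \<bullet> ?x = 0 \<longleftrightarrow> (\<forall>v\<in>S. w v * (b l - A l \<bullet> vertex_of \<Lambda> A b v) = 0)"
      unfolding inner_weighted_sum[OF w(2)]
      by (rule sum_nonneg_eq_0_iff[OF finS]) (rule slack[OF that])
    also have "\<dots> \<longleftrightarrow> (\<forall>v\<in>S. w v \<noteq> 0 \<longrightarrow> l \<in> v)"
    proof (intro ball_cong refl)
      fix v assume "v \<in> S"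
      then show "w v * (b l - A l \<bullet> vertex_of \<Lambda> A b v) = 0 \<longleftrightarrow> (w v \<noteq> 0 \<longrightarrow> l \<in> v)"
        using vertex_slack(2)[OF fin subsetD[OF S] that, of v] by auto
    qed
    finally show ?thesis .
  qed
  then show "l \<in> tight \<Lambda> A b ?x \<longleftrightarrow> l \<in> \<Lambda> \<and> (\<forall>v\<in>S. w v \<noteq> 0 \<longrightarrow> l \<in> v)"
    by (auto simp: tight_def)
qed

text \<open>
  The barycentre of a set of vertices lies in the interior of the smallest face that contains them.
\<close>

lemma tight_average:
  assumes fin: "finite \<Lambda>" and S: "S \<subseteq> polytope_type \<Lambda> A b" "S \<noteq> {}"
  defines "m \<equiv> \<Sum>v\<in>S. (1 / real (card S)) *\<^sub>R vertex_of \<Lambda> A b v"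
  shows "m \<in> halfspaces \<Lambda> A b" "tight \<Lambda> A b m = \<Inter>S"
proof -
  have finS: "finite S" using finite_subset[OF S(1) finite_polytope_type[OF fin]] .
  then have w: "(\<Sum>v\<in>S. 1 / real (card S)) = 1" "0 \<le> 1 / real (card S)" "1 / real (card S) \<noteq> 0"
    using S(2) by auto
  show "m \<in> halfspaces \<Lambda> A b"
    unfolding m_def by (rule tight_weighted_sum(1)[OF fin S(1) w(2,1)])
  show "tight \<Lambda> A b m = \<Inter>S"
    using tight_weighted_sum(2)[OF fin S(1) w(2,1)] w(3) S polytope_type_subset
    unfolding m_def[symmetric] by fastforce
qed

text \<open>
  Let \<open>m\<close> be the barycentre of the smallest face containing \<open>x\<close>. If \<open>x \<noteq> m\<close>,
  then the ray from \<open>m\<close> through \<open>x\<close> leaves the polytope at a point \<open>y\<close> with more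
  active labels. Weights for \<open>y\<close> are supported on a smaller face, so adding the layer for
  \<open>m\<close> below them keeps them admissible.
\<close>

lemma point_has_face_weights:
  fixes A :: "'l \<Rightarrow> real^'n"
  assumes fin: "finite \<Lambda>" and comp: "compact (halfspaces \<Lambda> A b)"
  defines "T \<equiv> polytope_type \<Lambda> A b" and "p \<equiv> vertex_of \<Lambda> A b"
  shows "x \<in> halfspaces \<Lambda> A b \<Longrightarrow>
    \<exists>w\<in>face_weights T. (\<forall>v. w v \<noteq> 0 \<longrightarrow> tight \<Lambda> A b x \<subseteq> v) \<and> (\<Sum>v\<in>T. w v *\<^sub>R p v) = x"
proof (induction "card (\<Lambda> - tight \<Lambda> A b x)" arbitrary: x rule: less_induct)
  case (less x)
  define \<sigma> where "\<sigma> = tight \<Lambda> A b x"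
  define V where "V = {v\<in>T. \<sigma> \<subseteq> v}"
  have finT: "finite T" unfolding T_def by (rule finite_polytope_type[OF fin])
  have V: "V \<subseteq> polytope_type \<Lambda> A b" "V \<noteq> {}"
    using face_vertex_avoiding[OF fin comp less.prems] by (auto simp: V_def T_def \<sigma>_def)
  have finV: "finite V" using finT by (simp add: V_def)
  define N where "N = real (card V)"
  have N: "N > 0" using finV V(2) by (simp add: N_def card_gt_0_iff)
  define m where "m = (\<Sum>v\<in>V. (1 / N) *\<^sub>R p v)"
  have m: "m \<in> halfspaces \<Lambda> A b" "tight \<Lambda> A b m = \<Inter>V"
    using tight_average[OF fin V] by (simp_all add: m_def N_def p_def)
  have "\<Inter>V = \<sigma>"
  proof
    show "\<Inter>V \<subseteq> \<sigma>"
    proof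
      fix l assume l: "l \<in> \<Inter>V"
      then have "l \<in> tight \<Lambda> A b m" using m(2) by simp
      then have "l \<in> \<Lambda>" by (simp add: tight_def)
      obtain v where v: "v \<in> T" "\<sigma> \<subseteq> v" "l \<in> \<Lambda> - \<sigma> \<longrightarrow> l \<notin> v"
        using face_vertex_avoiding[OF fin comp less.prems, of l] unfolding T_def \<sigma>_def by blast
      then have "v \<in> V" by (simp add: V_def)
      then have "l \<in> v" using l by simp
      then show "l \<in> \<sigma>" using v(3) \<open>l \<in> \<Lambda>\<close> by simp
    qed
  qed (auto simp: V_def)
  then have m2: "tight \<Lambda> A b m = \<sigma>" using m(2) by simp
  define s where "s = (\<lambda>l y. b l - A l \<bullet> y)"
  have sm: "s l m > 0" if "l \<in> \<Lambda> - \<sigma>" for l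
    using m(1) m2 that by (force simp: s_def halfspaces_def tight_def)
  have s0: "s l m = 0" "s l x = 0" if "l \<in> \<sigma>" for l
  proof -
    have "l \<in> tight \<Lambda> A b m" "l \<in> tight \<Lambda> A b x" using that m2 by (simp_all add: \<sigma>_def)
    then show "s l m = 0" "s l x = 0" by (simp_all add: s_def tight_def)
  qed
  have sx: "s l x \<ge> 0" if "l \<in> \<Lambda>" for l
    using less.prems that by (auto simp: s_def halfspaces_def)
  have mV: "(\<Sum>v\<in>T. (c / N * indicator V v) *\<^sub>R p v) = c *\<^sub>R m" for c
  proof -
    have "(\<Sum>v\<in>T. (c / N * indicator V v) *\<^sub>R p v) = (\<Sum>v\<in>T. if v \<in> V then (c / N) *\<^sub>R p v else 0)"
      by (rule sum.cong) (auto simp: indicator_def)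
    also have "\<dots> = (\<Sum>v\<in>V. (c / N) *\<^sub>R p v)"
      using finT by (simp add: sum.inter_filter[symmetric] V_def)
    also have "\<dots> = c *\<^sub>R m" by (simp add: m_def scaleR_sum_right)
    finally show ?thesis .
  qed
  have sV: "(\<Sum>v\<in>T. c / N * indicator V v) = c" for c
  proof -
    have "(\<Sum>v\<in>T. c / N * indicator V v) = c / N * card (T \<inter> V)"
      unfolding sum_distrib_left[symmetric] using finT by (simp add: indicator_def sum.If_cases)
    also have "T \<inter> V = V" by (auto simp: V_def)
    finally show ?thesis using N by (simp add: N_def)
  qed
  show ?case
  proof (cases "x = m")
    case True
    have "quasiconcave T (\<lambda>v. 0 + 1 / N * indicator {v\<in>T. \<sigma> \<subseteq> v} v)"
      using N by (intro quasiconcave_add_face) (auto simp: quasiconcave_def)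
    then have "(\<lambda>v. 1 / N * indicator V v) \<in> face_weights T"
      using sV[of 1] by (simp add: face_weights_def V_def)
    moreover have "(\<Sum>v\<in>T. (1 / N * indicator V v) *\<^sub>R p v) = x" using mV[of 1] True by simp
    moreover have "\<sigma> \<subseteq> v" if "1 / N * indicator V v \<noteq> 0" for v
      using that by (cases "v \<in> V") (auto simp: V_def)
    ultimately show ?thesis
      unfolding \<sigma>_def by (intro bexI[where x = "\<lambda>v. 1 / N * indicator V v"] conjI allI impI)
  next
    case False
    have "\<exists>l\<in>\<Lambda>. A l \<bullet> (x - m) > 0"
      using no_recession_direction[OF compact_imp_bounded[OF comp] m(1), of "x - m"] False
      by (metis eq_iff_diff_eq_0 not_less)
    then obtain l1 where l1: "l1 \<in> \<Lambda>" "s l1 x < s l1 m" by (auto simp: s_def inner_diff_right)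
    then have l1': "l1 \<in> \<Lambda> - \<sigma>" using s0[of l1] by auto
    \<comment> \<open>The largest \<open>c\<close> for which \<open>x - c *\<^sub>R m\<close> has no negative slack (with respect to \<open>1 - c\<close> times
      the right-hand sides); the label attaining the minimum becomes active at \<open>y\<close>.\<close>
    define R where "R = (\<lambda>l. s l x / s l m) ` (\<Lambda> - \<sigma>)"
    have finR: "finite R" "R \<noteq> {}" using fin l1' by (auto simp: R_def)
    define c where "c = Min R"
    have "c \<in> R" unfolding c_def using finR by (rule Min_in)
    then obtain l0 where l0: "l0 \<in> \<Lambda> - \<sigma>" "c = s l0 x / s l0 m" by (auto simp: R_def)
    have cle: "c * s l m \<le> s l x" if "l \<in> \<Lambda> - \<sigma>" for l
    proof -
      have "c \<le> s l x / s l m" unfolding c_def using finR that by (intro Min_le) (auto simp: R_def)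
      then show ?thesis using sm[OF that] by (simp add: field_simps)
    qed
    have c0: "0 \<le> c" using l0 sm[OF l0(1)] sx[of l0] by simp
    \<comment> \<open>Otherwise no slack of \<open>x\<close> is below that of \<open>m\<close>, and \<open>x - m\<close> would be a recession direction.\<close>
    have c1: "c < 1"
    proof -
      have "c * s l1 m < 1 * s l1 m" using cle[OF l1'] l1(2) by simp
      then show ?thesis using sm[OF l1'] by (simp only: mult_less_cancel_right_pos)
    qed
    define y where "y = (1 / (1 - c)) *\<^sub>R (x - c *\<^sub>R m)"
    have sy: "s l y = (s l x - c * s l m) / (1 - c)" for l
    proof -
      have "A l \<bullet> y = (A l \<bullet> x - c * (A l \<bullet> m)) / (1 - c)"
        by (simp add: y_def inner_diff_right)
      moreover have "b l = (b l - c * b l) / (1 - c)" using c1 by (simp add: field_simps)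
      ultimately have "s l y = (b l - c * b l) / (1 - c) - (A l \<bullet> x - c * (A l \<bullet> m)) / (1 - c)"
        by (simp add: s_def)
      then show ?thesis by (simp add: s_def diff_divide_distrib[symmetric] algebra_simps)
    qed
    have xy: "x = (1 - c) *\<^sub>R y + c *\<^sub>R m" using c1 by (simp add: y_def)
    have "s l y \<ge> 0" if "l \<in> \<Lambda>" for l
      using cle[of l] s0[of l] c1 that by (cases "l \<in> \<sigma>") (auto simp: sy)
    then have y: "y \<in> halfspaces \<Lambda> A b" by (auto simp: halfspaces_def s_def)
    have "s l0 y = 0" using l0 sm[OF l0(1)] by (simp add: sy)
    moreover have "s l y = 0" if "l \<in> \<sigma>" for l using s0[OF that] by (simp add: sy)
    ultimately have ty: "\<sigma> \<subseteq> tight \<Lambda> A b y" "l0 \<in> tight \<Lambda> A b y"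
      using l0(1) tight_subset[of \<Lambda> A b x] by (auto simp: tight_def s_def \<sigma>_def)
    then have "card (\<Lambda> - tight \<Lambda> A b y) < card (\<Lambda> - tight \<Lambda> A b x)"
      using l0(1) fin by (intro psubset_card_mono) (auto simp: \<sigma>_def)
    then obtain w where w: "w \<in> face_weights T" "\<And>v. w v \<noteq> 0 \<Longrightarrow> tight \<Lambda> A b y \<subseteq> v"
        "(\<Sum>v\<in>T. w v *\<^sub>R p v) = y"
      using less.hyps[OF _ y] by blast
    define w' where "w' = (\<lambda>v. (1 - c) * w v + c / N * indicator V v)"
    have "quasiconcave T (\<lambda>v. (1 - c) * w v)"
      using w(1) c1 by (auto simp: face_weights_def quasiconcave_def)
    then have "quasiconcave T w'"
      unfolding w'_def V_def using w(2) ty(1) c0 N by (intro quasiconcave_add_face) auto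
    moreover have "sum w' T = 1"
      using w(1) sV[of c] by (simp add: w'_def sum.distrib sum_distrib_left[symmetric] face_weights_def)
    moreover have "(\<Sum>v\<in>T. w' v *\<^sub>R p v) = x"
    proof -
      have "(\<Sum>v\<in>T. w' v *\<^sub>R p v) =
          (1 - c) *\<^sub>R (\<Sum>v\<in>T. w v *\<^sub>R p v) + (\<Sum>v\<in>T. (c / N * indicator V v) *\<^sub>R p v)"
        by (simp add: w'_def scaleR_left_distrib sum.distrib scaleR_sum_right)
      then show ?thesis unfolding mV w(3) using xy by simp
    qed
    moreover have "\<sigma> \<subseteq> v" if "w' v \<noteq> 0" for v
      using that w(2)[of v] ty(1) by (cases "v \<in> V") (auto simp: w'_def V_def)
    ultimately show ?thesis
      unfolding \<sigma>_def face_weights_def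
      by (intro bexI[where x = w'] conjI allI impI) auto
  qed
qed

lemma compact_face_weights:
  assumes fin: "finite T"
  shows "compact (face_weights T)"
proof -
  have cont: "continuous_on UNIV (\<lambda>w::'a set \<Rightarrow> real. w v)" for v
    by (rule continuous_on_product_coordinates)
  have "face_weights T = (\<Inter>v. {w. 0 \<le> w v}) \<inter> (\<Inter>v\<in>- T. {w. w v = 0}) \<inter>
      (\<Inter>(S, v)\<in>{(S, v). S \<subseteq> T \<and> S \<noteq> {} \<and> v \<in> T \<and> \<Inter>S \<subseteq> v}. \<Union>u\<in>S. {w. w u \<le> w v}) \<inter>
      {w. sum w T = 1}"
    unfolding face_weights_def quasiconcave_def by (intro set_eqI iffI) auto
  moreover have "closed (\<Inter>(S, v)\<in>{(S, v). S \<subseteq> T \<and> S \<noteq> {} \<and> v \<in> T \<and> \<Inter>S \<subseteq> v}.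
      \<Union>u\<in>S. {w :: 'a set \<Rightarrow> real. w u \<le> w v})"
    using fin by (intro closed_INT ballI) (auto intro!: closed_UN closed_Collect_le cont intro: finite_subset)
  moreover have "closed (\<Inter>v. {w::'a set \<Rightarrow> real. 0 \<le> w v})"
    by (intro closed_INT ballI closed_Collect_le cont continuous_on_const)
  moreover have "closed (\<Inter>v\<in>- T. {w::'a set \<Rightarrow> real. w v = 0})"
    by (intro closed_INT ballI closed_Collect_eq cont continuous_on_const)
  moreover have "closed {w::'a set \<Rightarrow> real. sum w T = 1}"
    by (intro closed_Collect_eq continuous_on_sum cont continuous_on_const)
  ultimately have clo: "closed (face_weights T)" by (simp only: closed_Int)
  have "compactin (product_topology (\<lambda>_. euclidean) UNIV) (PiE UNIV (\<lambda>v::'a set. if v \<in> T then {0..1::real} else {0}))"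
    by (auto simp: compactin_PiE)
  then have box: "compact (PiE UNIV (\<lambda>v::'a set. if v \<in> T then {0..1::real} else {0}))"
    by (simp add: euclidean_product_topology)
  have "face_weights T \<subseteq> PiE UNIV (\<lambda>v. if v \<in> T then {0..1} else {0})"
  proof
    fix w assume w: "w \<in> face_weights T"
    then have "w v \<le> 1" if "v \<in> T" for v
      using member_le_sum[OF that, of w] fin by (auto simp: face_weights_def quasiconcave_def)
    then show "w \<in> PiE UNIV (\<lambda>v. if v \<in> T then {0..1} else {0})"
      using w by (auto simp: face_weights_def quasiconcave_def)
  qed
  then show ?thesis using compact_Int_closed[OF box clo] by (simp add: Int_absorb1)
qed

text \<open>
  The interpolated vertices have slacks with the same zero pattern, being combinations of two
  nonnegative slacks that vanish simultaneously. So the weights are determined by the point at all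
  intermediate times.
\<close>

lemma interpolated_weights_determined:
  fixes A :: "'l \<Rightarrow> real^'n"
  assumes fin: "finite \<Lambda>" and T: "polytope_type \<Lambda> A b = T" "polytope_type \<Lambda> A b' = T"
    and w: "w \<in> face_weights T" "w' \<in> face_weights T" and t: "t \<in> {0..1}"
    and eq: "(1 - t) *\<^sub>R (\<Sum>v\<in>T. w v *\<^sub>R vertex_of \<Lambda> A b v) + t *\<^sub>R (\<Sum>v\<in>T. w v *\<^sub>R vertex_of \<Lambda> A b' v) =
      (1 - t) *\<^sub>R (\<Sum>v\<in>T. w' v *\<^sub>R vertex_of \<Lambda> A b v) + t *\<^sub>R (\<Sum>v\<in>T. w' v *\<^sub>R vertex_of \<Lambda> A b' v)"
  shows "w = w'"
proof -
  define g where "g = (\<lambda>l v. (1 - t) * (b l - A l \<bullet> vertex_of \<Lambda> A b v) + t * (b' l - A l \<bullet> vertex_of \<Lambda> A b' v))"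
  have slack: "0 \<le> b l - A l \<bullet> vertex_of \<Lambda> A b v" "b l - A l \<bullet> vertex_of \<Lambda> A b v = 0 \<longleftrightarrow> l \<in> v"
    "0 \<le> b' l - A l \<bullet> vertex_of \<Lambda> A b' v" "b' l - A l \<bullet> vertex_of \<Lambda> A b' v = 0 \<longleftrightarrow> l \<in> v"
    if "l \<in> \<Lambda>" "v \<in> T" for l v
    using vertex_slack[OF fin, of v A b l] vertex_slack[OF fin, of v A b' l] T that by blast+
  have nn: "0 \<le> g l v" if "l \<in> \<Lambda>" "v \<in> T" for l v
    using slack(1,3)[OF that] t by (auto simp: g_def intro!: add_nonneg_nonneg mult_nonneg_nonneg)
  have zero: "g l v = 0 \<longleftrightarrow> l \<in> v" if lv: "l \<in> \<Lambda>" "v \<in> T" for l v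
  proof -
    have "0 \<le> (1 - t) * (b l - A l \<bullet> vertex_of \<Lambda> A b v)" "0 \<le> t * (b' l - A l \<bullet> vertex_of \<Lambda> A b' v)"
      using slack(1,3)[OF lv] t by (auto intro!: mult_nonneg_nonneg)
    then have "g l v = 0 \<longleftrightarrow> (1 - t) * (b l - A l \<bullet> vertex_of \<Lambda> A b v) = 0 \<and>
        t * (b' l - A l \<bullet> vertex_of \<Lambda> A b' v) = 0"
      unfolding g_def by (rule add_nonneg_eq_0_iff)
    then show ?thesis using slack(2,4)[OF lv] by (cases "t = 0") (auto simp only: mult_eq_0_iff; force)+
  qed
  have val: "(\<Sum>v\<in>T. u v * g l v) = (1 - t) * b l + t * b' l -
      A l \<bullet> ((1 - t) *\<^sub>R (\<Sum>v\<in>T. u v *\<^sub>R vertex_of \<Lambda> A b v) + t *\<^sub>R (\<Sum>v\<in>T. u v *\<^sub>R vertex_of \<Lambda> A b' v))"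
    if "u \<in> face_weights T" for u l
  proof -
    have one: "sum u T = 1" using that by (simp add: face_weights_def)
    have "(\<Sum>v\<in>T. u v * g l v) = (1 - t) * (\<Sum>v\<in>T. u v * (b l - A l \<bullet> vertex_of \<Lambda> A b v)) +
        t * (\<Sum>v\<in>T. u v * (b' l - A l \<bullet> vertex_of \<Lambda> A b' v))"
      unfolding sum_distrib_left sum.distrib[symmetric] g_def by (intro sum.cong) (simp_all add: algebra_simps)
    then show ?thesis
      unfolding inner_weighted_sum[OF one, symmetric] by (simp add: inner_add_right algebra_simps)
  qed
  show ?thesis
  proof (rule weights_determined_by_slacks[where g = g and \<Lambda> = \<Lambda>])
    show "finite T" "T \<subseteq> Pow \<Lambda>"
      using finite_polytope_type[OF fin, of A b] polytope_type_subset[of _ \<Lambda> A b] T(1) by auto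
    show "(\<Sum>v\<in>T. w v * g l v) = (\<Sum>v\<in>T. w' v * g l v)" for l
      unfolding val[OF w(1)] val[OF w(2)] eq ..
  qed (use nn zero w in \<open>auto simp: face_weights_def\<close>)
qed

section \<open>Polytopes sharing a face\<close>

text \<open>
  Translation by \<open>h\<close> identifies the face of the first polytope on which the labels in \<open>\<tau>\<close>
  are active with a face of the second. The two systems of inequalities may have nothing else in
  common; all the following facts are derived from this equality of sets.
\<close>

definition translates_face ::
  "'l set \<Rightarrow> ('l \<Rightarrow> real^'n) \<Rightarrow> ('l \<Rightarrow> real) \<Rightarrow> 'l set \<Rightarrow> real^'n \<Rightarrow>
   'm set \<Rightarrow> ('m \<Rightarrow> real^'n) \<Rightarrow> ('m \<Rightarrow> real) \<Rightarrow> 'm set \<Rightarrow> bool" where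
  "translates_face \<Lambda> A b \<tau> h \<Lambda>' A' b' \<tau>' \<longleftrightarrow>
     (\<forall>z. (z \<in> halfspaces \<Lambda> A b \<and> \<tau> \<subseteq> tight \<Lambda> A b z) \<longleftrightarrow>
          (z + h \<in> halfspaces \<Lambda>' A' b' \<and> \<tau>' \<subseteq> tight \<Lambda>' A' b' (z + h)))"

lemma translates_face_sym:
  assumes "translates_face \<Lambda> A b \<tau> h \<Lambda>' A' b' \<tau>'"
  shows "translates_face \<Lambda>' A' b' \<tau>' (- h) \<Lambda> A b \<tau>"
  unfolding translates_face_def
proof
  fix z
  from assms have "(z - h \<in> halfspaces \<Lambda> A b \<and> \<tau> \<subseteq> tight \<Lambda> A b (z - h)) \<longleftrightarrow>
      (z - h + h \<in> halfspaces \<Lambda>' A' b' \<and> \<tau>' \<subseteq> tight \<Lambda>' A' b' (z - h + h))"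
    unfolding translates_face_def by blast
  then show "(z \<in> halfspaces \<Lambda>' A' b' \<and> \<tau>' \<subseteq> tight \<Lambda>' A' b' z) \<longleftrightarrow>
      (z + - h \<in> halfspaces \<Lambda> A b \<and> \<tau> \<subseteq> tight \<Lambda> A b (z + - h))" by simp
qed

text \<open>
  A direction orthogonal to the active rows at \<open>x + h\<close> can be followed a little both ways within
  the second face, hence also within the first, where \<open>x\<close> is a vertex.
\<close>

lemma translated_vertex:
  assumes fin: "finite \<Lambda>'" and tr: "translates_face \<Lambda> A b \<tau> h \<Lambda>' A' b' \<tau>'"
    and x: "is_vertex \<Lambda> A b x" "\<tau> \<subseteq> tight \<Lambda> A b x"
  shows "is_vertex \<Lambda>' A' b' (x + h)" "\<tau>' \<subseteq> tight \<Lambda>' A' b' (x + h)"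
proof -
  have mem: "x + h \<in> halfspaces \<Lambda>' A' b'" "\<tau>' \<subseteq> tight \<Lambda>' A' b' (x + h)"
    using tr x by (auto simp: translates_face_def is_vertex_def)
  then show "\<tau>' \<subseteq> tight \<Lambda>' A' b' (x + h)" by simp
  have dir: "\<forall>l\<in>tight \<Lambda> A b x. A l \<bullet> d \<le> 0" if d: "\<forall>l\<in>tight \<Lambda>' A' b' (x + h). A' l \<bullet> d = 0" for d
  proof -
    obtain \<epsilon> where \<epsilon>: "\<epsilon> > 0" "x + h + \<epsilon> *\<^sub>R d \<in> halfspaces \<Lambda>' A' b'"
      using small_step_feasible[OF fin mem(1), of d] d by auto
    moreover have "\<tau>' \<subseteq> tight \<Lambda>' A' b' (x + h + \<epsilon> *\<^sub>R d)"
      using d mem(2) by (auto simp: tight_def inner_add_right subset_iff)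
    ultimately have "x + \<epsilon> *\<^sub>R d \<in> halfspaces \<Lambda> A b"
      using tr[unfolded translates_face_def, rule_format, of "x + \<epsilon> *\<^sub>R d"]
      by (simp add: algebra_simps)
    then show ?thesis
      using \<epsilon>(1) by (auto simp: tight_def halfspaces_def inner_add_right mult_le_0_iff)
  qed
  show "is_vertex \<Lambda>' A' b' (x + h)"
    unfolding is_vertex_def
  proof (intro conjI allI impI mem(1))
    fix d assume "\<forall>l\<in>tight \<Lambda>' A' b' (x + h). A' l \<bullet> d = 0"
    then have "\<forall>l\<in>tight \<Lambda> A b x. A l \<bullet> d \<le> 0" "\<forall>l\<in>tight \<Lambda> A b x. A l \<bullet> (- d) \<le> 0"
      using dir[of d] dir[of "- d"] by auto
    then have "\<forall>l\<in>tight \<Lambda> A b x. A l \<bullet> d = 0" by (auto intro: antisym)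
    then show "d = 0" using x(1) by (auto simp: is_vertex_def)
  qed
qed

text \<open>
  The correspondence of the vertices of a common face is the same for both parameters. Let \<open>q\<close>
  be the vertex for \<open>r'\<close> that carries the label set \<open>v''\<close> obtained from \<open>v\<close> by means of
  \<open>s\<close>. The direction \<open>d\<close> from the vertex \<open>v\<close> to \<open>q - h\<close> is feasible for \<open>r\<close>, hence
  also for \<open>s\<close> at the vertex with the same active labels. Translated to the second polytope,
  this shows that \<open>d\<close> does not increase any row in \<open>v''\<close>; going back from \<open>q\<close> along
  \<open>- d\<close>, these rows therefore stay active, which forces the end point to be \<open>q\<close> itself.
\<close>

lemma translated_vertex_label:
  assumes fin: "finite \<Lambda>" "finite \<Lambda>'"
    and trr: "translates_face \<Lambda> A r \<tau> h \<Lambda>' A' r' \<tau>'" and trs: "translates_face \<Lambda> A s \<tau> h \<Lambda>' A' s' \<tau>'"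
    and T: "polytope_type \<Lambda> A r = polytope_type \<Lambda> A s"
    and T': "polytope_type \<Lambda>' A' r' = polytope_type \<Lambda>' A' s'"
    and v: "v \<in> polytope_type \<Lambda> A r" "\<tau> \<subseteq> v"
  shows "tight \<Lambda>' A' r' (vertex_of \<Lambda> A r v + h) = tight \<Lambda>' A' s' (vertex_of \<Lambda> A s v + h)"
proof -
  define x where "x = vertex_of \<Lambda> A r v"
  define y where "y = vertex_of \<Lambda> A s v"
  have x: "is_vertex \<Lambda> A r x" "tight \<Lambda> A r x = v" using vertex_of[OF fin(1) v(1)] by (auto simp: x_def)
  have y: "is_vertex \<Lambda> A s y" "tight \<Lambda> A s y = v"
    using vertex_of[OF fin(1), of v A s] v(1) T by (auto simp: y_def)
  note xh = translated_vertex[OF fin(2) trr x(1), unfolded x(2), OF v(2)]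
  note yh = translated_vertex[OF fin(2) trs y(1), unfolded y(2), OF v(2)]
  define v'' where "v'' = tight \<Lambda>' A' s' (y + h)"
  have v'': "v'' \<in> polytope_type \<Lambda>' A' r'"
    using vertex_of_tight(1)[OF fin(2) yh(1)] T' by (simp add: v''_def)
  define q where "q = vertex_of \<Lambda>' A' r' v''"
  have q: "is_vertex \<Lambda>' A' r' q" "tight \<Lambda>' A' r' q = v''"
    using vertex_of[OF fin(2) v''] by (auto simp: q_def)
  define d where "d = q - h - x"
  have qh: "q - h \<in> halfspaces \<Lambda> A r" "\<tau> \<subseteq> tight \<Lambda> A r (q - h)"
    using trr[unfolded translates_face_def, rule_format, of "q - h"] q yh(2)
    by (auto simp: is_vertex_def v''_def)
  have dv: "\<forall>l\<in>v. A l \<bullet> d \<le> 0"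
    using qh(1) x(2) by (auto simp: d_def inner_diff_right tight_def halfspaces_def)
  have dt: "\<forall>l\<in>\<tau>. A l \<bullet> d = 0"
  proof
    fix l assume "l \<in> \<tau>"
    then have "l \<in> tight \<Lambda> A r (q - h)" "l \<in> tight \<Lambda> A r x" using qh(2) x(2) v(2) by auto
    then show "A l \<bullet> d = 0" by (simp add: d_def inner_diff_right tight_def)
  qed
  obtain \<epsilon> where \<epsilon>: "\<epsilon> > 0" "y + \<epsilon> *\<^sub>R d \<in> halfspaces \<Lambda> A s"
    using small_step_feasible[OF fin(1), of y A s d] y dv by (auto simp: is_vertex_def)
  moreover have "\<tau> \<subseteq> tight \<Lambda> A s (y + \<epsilon> *\<^sub>R d)"
    using dt y(2) v(2) by (auto simp: tight_def inner_add_right subset_iff)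
  ultimately have mem: "y + \<epsilon> *\<^sub>R d + h \<in> halfspaces \<Lambda>' A' s'"
    using trs by (auto simp: translates_face_def)
  have d': "A' l \<bullet> d \<le> 0" if "l \<in> v''" for l
  proof -
    have "A' l \<bullet> (y + \<epsilon> *\<^sub>R d + h) \<le> s' l" "A' l \<bullet> (y + h) = s' l"
      using mem that by (auto simp: v''_def tight_def halfspaces_def)
    then have "\<epsilon> * (A' l \<bullet> d) \<le> 0" by (simp add: inner_add_right)
    then show ?thesis using \<epsilon>(1) by (simp add: mult_le_0_iff)
  qed
  have "v'' \<subseteq> tight \<Lambda>' A' r' (x + h)"
  proof
    fix l assume l: "l \<in> v''"
    then have "A' l \<bullet> q = r' l" "l \<in> \<Lambda>'" using q(2) by (auto simp: tight_def)
    moreover have "x + h = q - d" by (simp add: d_def)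
    ultimately have "r' l \<le> A' l \<bullet> (x + h)" using d'[OF l] by (simp add: inner_diff_right)
    moreover have "A' l \<bullet> (x + h) \<le> r' l" using xh(1) \<open>l \<in> \<Lambda>'\<close> by (auto simp: is_vertex_def halfspaces_def)
    ultimately show "l \<in> tight \<Lambda>' A' r' (x + h)" using \<open>l \<in> \<Lambda>'\<close> by (auto simp: tight_def)
  qed
  then have "q = x + h" using vertex_determined[OF q(1)] q(2) by simp
  then show ?thesis using q(2) by (simp add: v''_def x_def y_def)
qed

text \<open>
  The correspondence of vertices preserves the relation of lying in the smallest face of a set of
  vertices. For \<open>v\<close> lies in the smallest face of \<open>S\<close> exactly if the segment from \<open>v\<close> to
  the barycentre of \<open>S\<close> can be prolonged beyond the barycentre, and this is preserved by
  translations.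
\<close>

lemma translated_closure:
  assumes fin: "finite \<Lambda>" "finite \<Lambda>'" and tr: "translates_face \<Lambda> A b \<tau> h \<Lambda>' A' b' \<tau>'"
    and S: "S \<subseteq> polytope_type \<Lambda> A b" "S \<noteq> {}" "\<And>u. u \<in> S \<Longrightarrow> \<tau> \<subseteq> u"
    and v: "v \<in> polytope_type \<Lambda> A b" "\<tau> \<subseteq> v"
    and sub: "(\<Inter>u\<in>S. tight \<Lambda>' A' b' (vertex_of \<Lambda> A b u + h)) \<subseteq> tight \<Lambda>' A' b' (vertex_of \<Lambda> A b v + h)"
  shows "\<Inter>S \<subseteq> v"
proof -
  let ?p = "vertex_of \<Lambda> A b"
  define m where "m = (\<Sum>u\<in>S. (1 / real (card S)) *\<^sub>R ?p u)"
  have m: "m \<in> halfspaces \<Lambda> A b" "tight \<Lambda> A b m = \<Inter>S"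
    unfolding m_def by (rule tight_average[OF fin(1) S(1,2)])+
  have mh: "m + h \<in> halfspaces \<Lambda>' A' b'" "\<tau>' \<subseteq> tight \<Lambda>' A' b' (m + h)"
    using tr m S(2,3) by (auto simp: translates_face_def)
  have finS: "finite S" using finite_subset[OF S(1) finite_polytope_type[OF fin(1)]] .
  have pu: "?p u + h \<in> halfspaces \<Lambda>' A' b'" if "u \<in> S" for u
    using tr[unfolded translates_face_def, rule_format, of "?p u"]
      vertex_of[OF fin(1), of u A b] S(1,3) that unfolding is_vertex_def by (metis subsetD)
  have mh_sub: "tight \<Lambda>' A' b' (m + h) \<subseteq> tight \<Lambda>' A' b' (?p v + h)"
  proof -
    have "tight \<Lambda>' A' b' (m + h) \<subseteq> tight \<Lambda>' A' b' (?p u + h)" if u: "u \<in> S" for u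
    proof
      fix l assume l: "l \<in> tight \<Lambda>' A' b' (m + h)"
      then have l': "l \<in> \<Lambda>'" "A' l \<bullet> (m + h) = b' l" by (auto simp: tight_def)
      have one: "(\<Sum>u\<in>S. 1 / real (card S)) = 1" using finS S(2) by simp
      have "(\<Sum>u\<in>S. (1 / real (card S)) * (b' l - A' l \<bullet> (?p u + h))) = 0"
      proof -
        have "m + h = (\<Sum>u\<in>S. (1 / real (card S)) *\<^sub>R (?p u + h))"
        proof -
          have "(\<Sum>u\<in>S. (1 / real (card S)) *\<^sub>R (?p u + h)) = m + (\<Sum>u\<in>S. 1 / real (card S)) *\<^sub>R h"
            by (simp only: scaleR_right_distrib sum.distrib m_def scaleR_sum_left)
          then show ?thesis by (simp only: one scaleR_one)
        qed
        then show ?thesis using inner_weighted_sum[OF one, of b' l "A' l" "\<lambda>u. ?p u + h"] l'(2) by simp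
      qed
      moreover have "0 \<le> (1 / real (card S)) * (b' l - A' l \<bullet> (?p u + h))" if "u \<in> S" for u
        using pu[OF that] l'(1) by (auto simp: halfspaces_def)
      ultimately have "(1 / real (card S)) * (b' l - A' l \<bullet> (?p u + h)) = 0"
        using u finS by (metis (no_types, lifting) sum_nonneg_eq_0_iff)
      then show "l \<in> tight \<Lambda>' A' b' (?p u + h)" using l'(1) finS S(2) by (auto simp: tight_def)
    qed
    then show ?thesis using sub by blast
  qed
  define d where "d = m - ?p v"
  have d: "\<forall>l\<in>tight \<Lambda>' A' b' (m + h). A' l \<bullet> d = 0"
    using mh_sub by (auto simp: d_def tight_def inner_diff_right inner_add_right subset_iff)
  then obtain \<epsilon> where \<epsilon>: "\<epsilon> > 0" "m + h + \<epsilon> *\<^sub>R d \<in> halfspaces \<Lambda>' A' b'"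
    using small_step_feasible[OF fin(2) mh(1), of d] by auto
  moreover have "\<tau>' \<subseteq> tight \<Lambda>' A' b' (m + h + \<epsilon> *\<^sub>R d)"
    using d mh(2) by (auto simp: tight_def inner_add_right subset_iff)
  ultimately have mem: "m + \<epsilon> *\<^sub>R d \<in> halfspaces \<Lambda> A b"
    using tr[unfolded translates_face_def, rule_format, of "m + \<epsilon> *\<^sub>R d"] by (simp add: algebra_simps)
  show ?thesis
  proof
    fix l assume "l \<in> \<Inter>S"
    then have l: "l \<in> \<Lambda>" "A l \<bullet> m = b l" using m(2) by (auto simp: tight_def)
    have "A l \<bullet> (m + \<epsilon> *\<^sub>R d) \<le> b l" using mem l(1) by (auto simp: halfspaces_def)
    then have "\<epsilon> * (b l - A l \<bullet> ?p v) \<le> 0" using l(2) by (simp add: d_def inner_add_right inner_diff_right)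
    then have "b l - A l \<bullet> ?p v \<le> 0" using \<epsilon>(1) by (simp add: mult_le_0_iff)
    then show "l \<in> v" using vertex_slack[OF fin(1) v(1) l(1)] by simp
  qed
qed

text \<open>
  Since admissible weights have superlevel sets that are faces, and faces of the common face are
  faces of either polytope, extending the transported weights by zero keeps them admissible.
\<close>

lemma transport_face_weights:
  assumes fin: "finite \<Lambda>" "finite \<Lambda>'"
    and trr: "translates_face \<Lambda> A r \<tau> h \<Lambda>' A' r' \<tau>'" and trs: "translates_face \<Lambda> A s \<tau> h \<Lambda>' A' s' \<tau>'"
    and T: "polytope_type \<Lambda> A r = T" "polytope_type \<Lambda> A s = T"
    and T': "polytope_type \<Lambda>' A' r' = T'" "polytope_type \<Lambda>' A' s' = T'"
    and w: "w \<in> face_weights T" "\<And>v. w v \<noteq> 0 \<Longrightarrow> \<tau> \<subseteq> v"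
  shows "\<exists>w'\<in>face_weights T'.
     (\<Sum>v\<in>T'. w' v *\<^sub>R vertex_of \<Lambda>' A' r' v) = (\<Sum>v\<in>T. w v *\<^sub>R vertex_of \<Lambda> A r v) + h \<and>
     (\<Sum>v\<in>T'. w' v *\<^sub>R vertex_of \<Lambda>' A' s' v) = (\<Sum>v\<in>T. w v *\<^sub>R vertex_of \<Lambda> A s v) + h"
proof -
  let ?p = "vertex_of \<Lambda> A r" and ?p' = "vertex_of \<Lambda>' A' r'"
  let ?ps = "vertex_of \<Lambda> A s" and ?ps' = "vertex_of \<Lambda>' A' s'"
  define \<phi> where "\<phi> = (\<lambda>v. tight \<Lambda>' A' r' (?p v + h))"
  define \<psi> where "\<psi> = (\<lambda>v. tight \<Lambda> A r (?p' v - h))"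
  define V where "V = {v\<in>T. \<tau> \<subseteq> v}"
  define V' where "V' = {v\<in>T'. \<tau>' \<subseteq> v}"
  have finT: "finite T" "finite T'" using finite_polytope_type fin T T' by auto
  have \<phi>: "\<phi> v \<in> V'" "?p' (\<phi> v) = ?p v + h" "\<psi> (\<phi> v) = v" if "v \<in> V" for v
  proof -
    have x: "is_vertex \<Lambda> A r (?p v)" "tight \<Lambda> A r (?p v) = v" "\<tau> \<subseteq> v"
      using vertex_of[OF fin(1), of v A r] that T by (simp_all add: V_def)
    note y = translated_vertex[OF fin(2) trr x(1), unfolded x(2), OF x(3)]
    show "\<phi> v \<in> V'" "?p' (\<phi> v) = ?p v + h"
      using vertex_of_tight[OF fin(2) y(1)] y(2) T' by (auto simp: V'_def \<phi>_def)
    then show "\<psi> (\<phi> v) = v" using x(2) by (simp add: \<psi>_def)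
  qed
  have \<psi>: "\<psi> v \<in> V" "?p (\<psi> v) = ?p' v - h" "?ps (\<psi> v) = ?ps' v - h" "\<phi> (\<psi> v) = v" if "v \<in> V'" for v
  proof -
    have x4: "\<tau>' \<subseteq> v" "v \<in> polytope_type \<Lambda>' A' r'" "v \<in> polytope_type \<Lambda>' A' s'"
      using that T' by (auto simp: V'_def)
    have x: "is_vertex \<Lambda>' A' r' (?p' v)" "tight \<Lambda>' A' r' (?p' v) = v" "\<tau>' \<subseteq> v" "v \<in> polytope_type \<Lambda>' A' r'"
      and xs: "is_vertex \<Lambda>' A' s' (?ps' v)" "tight \<Lambda>' A' s' (?ps' v) = v"
      using vertex_of[OF fin(2) x4(2)] vertex_of[OF fin(2) x4(3)] x4 by simp_all
    note y = translated_vertex[OF fin(1) translates_face_sym[OF trr] x(1), unfolded x(2), OF x(3)]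
    note ys = translated_vertex[OF fin(1) translates_face_sym[OF trs] xs(1), unfolded xs(2), OF x(3)]
    show "\<psi> v \<in> V" "?p (\<psi> v) = ?p' v - h"
      using vertex_of_tight[OF fin(1) y(1)] y(2) T by (auto simp: V_def \<psi>_def)
    then show "\<phi> (\<psi> v) = v" using x(2) by (simp add: \<phi>_def)
    have "\<psi> v = tight \<Lambda> A s (?ps' v - h)"
      using translated_vertex_label[OF fin(2,1) translates_face_sym[OF trr] translates_face_sym[OF trs]
          _ _ x(4,3)] T T' by (simp add: \<psi>_def)
    then show "?ps (\<psi> v) = ?ps' v - h"
      using vertex_of_tight(2)[OF fin(1) ys(1)] by simp
  qed
  have wV: "w v = 0" if "v \<notin> V" for v
    using that w by (auto simp: V_def face_weights_def quasiconcave_def)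
  define w' where "w' = (\<lambda>v. if v \<in> V' then w (\<psi> v) else 0)"
  have reindex: "(\<Sum>v\<in>T'. w' v *\<^sub>R f v) = (\<Sum>v\<in>T. w v *\<^sub>R (g v))"
    if "\<And>v. v \<in> V' \<Longrightarrow> f v = g (\<psi> v)" for f g :: "_ \<Rightarrow> 'd::real_vector"
  proof -
    have "(\<Sum>v\<in>T'. w' v *\<^sub>R f v) = (\<Sum>v\<in>V'. w' v *\<^sub>R f v)"
      using finT by (intro sum.mono_neutral_right) (auto simp: V'_def w'_def)
    also have "\<dots> = (\<Sum>v\<in>V. w v *\<^sub>R g v)"
      by (rule sum.reindex_bij_witness[of _ \<phi> \<psi>]) (auto simp: \<phi> \<psi> w'_def that)
    also have "\<dots> = (\<Sum>v\<in>T. w v *\<^sub>R g v)"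
      using finT wV by (intro sum.mono_neutral_left) (auto simp: V_def)
    finally show ?thesis .
  qed
  have sumw: "sum w T = 1" using w(1) by (simp add: face_weights_def)
  have "sum w' T' = 1" using reindex[of "\<lambda>_. 1::real" "\<lambda>_. 1"] sumw by simp
  moreover have "quasiconcave T' w'"
    unfolding quasiconcave_def
  proof (intro conjI allI impI)
    have nn: "0 \<le> w v" for v using w(1) by (simp add: face_weights_def quasiconcave_def)
    then show nn': "0 \<le> w' v" for v by (simp add: w'_def)
    show "w' v = 0" if "v \<notin> T'" for v using that by (simp add: w'_def V'_def)
    fix S v assume S: "S \<subseteq> T' \<and> S \<noteq> {} \<and> v \<in> T' \<and> \<Inter>S \<subseteq> v"
    show "\<exists>u\<in>S. w' u \<le> w' v"
    proof (cases "S \<subseteq> V'")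
      case False
      then obtain u where u: "u \<in> S" "u \<notin> V'" by blast
      then have "w' u = 0" by (simp add: w'_def)
      then show ?thesis using u(1) nn'[of v] by (metis)
    next
      case True
      moreover have "\<tau>' \<subseteq> \<Inter>S" using True by (auto simp: V'_def)
      ultimately have v: "v \<in> V'" using S unfolding V'_def by blast
      have "\<Inter>(\<psi> ` S) \<subseteq> \<psi> v"
      proof (rule translated_closure[OF fin trr])
        have "tight \<Lambda>' A' r' (?p (\<psi> u) + h) = u" if "u \<in> V'" for u
          using \<psi>(2,4)[OF that] by (simp add: \<phi>_def)
        then show "(\<Inter>u\<in>\<psi> ` S. tight \<Lambda>' A' r' (?p u + h)) \<subseteq> tight \<Lambda>' A' r' (?p (\<psi> v) + h)"
          using S True v by (auto simp: subset_iff)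
      qed (use \<psi>(1) True v S in \<open>auto simp: V_def T\<close>)
      moreover have "\<psi> ` S \<subseteq> T" "\<psi> v \<in> T" using \<psi>(1) True v by (auto simp: V_def)
      ultimately obtain u where "u \<in> \<psi> ` S" "w u \<le> w (\<psi> v)"
        using w(1) S unfolding face_weights_def quasiconcave_def by blast
      then show ?thesis using True v by (auto simp: w'_def)
    qed
  qed
  ultimately have "w' \<in> face_weights T'" by (simp add: face_weights_def)
  moreover have "(\<Sum>v\<in>T'. w' v *\<^sub>R ?p' v) = (\<Sum>v\<in>T. w v *\<^sub>R (?p v + h))"
    by (rule reindex) (simp add: \<psi>)
  moreover have "(\<Sum>v\<in>T'. w' v *\<^sub>R ?ps' v) = (\<Sum>v\<in>T. w v *\<^sub>R (?ps v + h))"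
    by (rule reindex) (simp add: \<psi>)
  moreover have "(\<Sum>v\<in>T. w v *\<^sub>R (f v + h)) = (\<Sum>v\<in>T. w v *\<^sub>R f v) + h" for f
    using sumw by (simp add: scaleR_right_distrib sum.distrib flip: scaleR_sum_left)
  ultimately show ?thesis by auto
qed

section \<open>Isotopies from families of compact pieces\<close>

text \<open>
  The pieces \<open>K c\<close> cover the moving subspace, and by \<open>sep\<close> the identifications between points
  of the pieces do not change with time. So the motion descends to the subspace at time \<open>0\<close>.
  It is continuous there because \<open>(k, t) \<mapsto> (F c (k, 0), t)\<close> is a closed map, going from a compact
  space to a Hausdorff space; for the same reason the injective maps at fixed times are embeddings.
\<close>

lemma isotopic_in_compact_family:
  fixes K :: "'c \<Rightarrow> 'k topology" and F :: "'c \<Rightarrow> 'k \<times> real \<Rightarrow> 'z"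
  assumes haus: "Hausdorff_space Z" and fin: "finite C"
    and comp: "\<And>c. c \<in> C \<Longrightarrow> compact_space (K c)"
    and cont: "\<And>c. c \<in> C \<Longrightarrow> continuous_map (prod_topology (K c) (top_of_set {0..1})) Z (F c)"
    and sep: "\<And>c c' k k' t u. \<lbrakk>c \<in> C; c' \<in> C; k \<in> topspace (K c); k' \<in> topspace (K c');
       t \<in> {0..1}; u \<in> {0..1}; F c (k, t) = F c' (k', t)\<rbrakk> \<Longrightarrow> F c (k, u) = F c' (k', u)"
  shows "isotopic_in Z (\<Union>c\<in>C. (\<lambda>k. F c (k, 0)) ` topspace (K c))
                       (\<Union>c\<in>C. (\<lambda>k. F c (k, 1)) ` topspace (K c))"
proof -
  let ?I = "top_of_set {0..1::real}"
  define X where "X = (\<Union>c\<in>C. (\<lambda>k. F c (k, 0)) ` topspace (K c))"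
  have slice: "continuous_map (K c) Z (\<lambda>k. F c (k, t))" if "c \<in> C" "t \<in> {0..1}" for c t
  proof -
    have "continuous_map (K c) (prod_topology (K c) ?I) (\<lambda>k. (k, t))"
      using that(2) by (auto intro!: continuous_map_pairedI)
    from continuous_map_compose[OF this cont[OF that(1)]] show ?thesis by (simp add: o_def)
  qed
  have FZ: "F c (k, t) \<in> topspace Z" if "c \<in> C" "k \<in> topspace (K c)" "t \<in> {0..1}" for c k t
    using continuous_map_image_subset_topspace[OF slice[OF that(1,3)]] that(2) by auto
  have XZ: "X \<subseteq> topspace Z" using FZ by (auto simp: X_def)
  have "compactin Z ((\<lambda>k. F c (k, 0)) ` topspace (K c))" if "c \<in> C" for c
    by (rule image_compactin[OF _ slice[OF that]]) (use comp[OF that] in \<open>auto simp: compact_space_def\<close>)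
  then have compX: "compact_space (subtopology Z X)"
    unfolding X_def using fin by (intro compact_space_subtopology compactin_Union) auto
  define pick where "pick = (\<lambda>x. SOME (c, k). c \<in> C \<and> k \<in> topspace (K c) \<and> F c (k, 0) = x)"
  define \<Phi> where "\<Phi> = (\<lambda>(x, t). F (fst (pick x)) (snd (pick x), t))"
  have \<Phi>: "\<Phi> (F c (k, 0), t) = F c (k, t)" if "c \<in> C" "k \<in> topspace (K c)" "t \<in> {0..1}" for c k t
  proof -
    have "\<exists>ck. case ck of (c', k') \<Rightarrow> c' \<in> C \<and> k' \<in> topspace (K c') \<and> F c' (k', 0) = F c (k, 0)"
      using that by auto
    from someI_ex[OF this] obtain c' k' where p: "pick (F c (k, 0)) = (c', k')"
      "c' \<in> C" "k' \<in> topspace (K c')" "F c' (k', 0) = F c (k, 0)"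
      by (auto simp: pick_def split: prod.splits)
    then have "F c' (k', t) = F c (k, t)"
      using sep[of c' c k' k 0 t] that by auto
    then show ?thesis by (simp add: \<Phi>_def p(1))
  qed
  let ?P = "prod_topology (subtopology Z X) ?I"
  have hausX: "Hausdorff_space (subtopology Z X)" using haus by (rule Hausdorff_space_subtopology)
  then have hausP: "Hausdorff_space ?P"
    by (simp add: Hausdorff_space_prod_topology Hausdorff_space_subtopology)
  have cont\<Phi>: "continuous_map ?P Z \<Phi>"
    unfolding continuous_map_closedin
  proof (intro conjI allI impI)
    show "\<Phi> \<in> topspace ?P \<rightarrow> topspace Z"
      using \<Phi> FZ by (auto simp: X_def)
    fix B assume B: "closedin Z B"
    let ?q = "\<lambda>c (z :: 'k \<times> real). (F c (fst z, 0), snd z)"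
    let ?D = "\<lambda>c. prod_topology (K c) ?I"
    have q: "closedin ?P (?q c ` {z \<in> topspace (?D c). F c z \<in> B})" if c: "c \<in> C" for c
    proof -
      have "continuous_map (?D c) Z (\<lambda>z. F c (fst z, 0))"
        using continuous_map_compose[OF continuous_map_fst slice[OF c, of 0]] by (simp add: o_def)
      then have "continuous_map (?D c) (subtopology Z X) (\<lambda>z. F c (fst z, 0))"
        using c by (auto simp: continuous_map_in_subtopology X_def)
      then have "continuous_map (?D c) ?P (?q c)"
        by (intro continuous_map_pairedI continuous_map_snd)
      then have "closed_map (?D c) ?P (?q c)"
        using comp[OF c] hausP
        by (intro continuous_imp_closed_map) (auto simp: compact_space_prod_topology compact_space_subtopology)
      moreover have "closedin (?D c) {z \<in> topspace (?D c). F c z \<in> B}"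
        using cont[OF c] B by (rule closedin_continuous_map_preimage)
      ultimately show ?thesis by (auto simp: closed_map_def)
    qed
    have "{z \<in> topspace ?P. \<Phi> z \<in> B} = (\<Union>c\<in>C. ?q c ` {z \<in> topspace (?D c). F c z \<in> B})"
    proof (intro set_eqI iffI)
      fix z assume z: "z \<in> {z \<in> topspace ?P. \<Phi> z \<in> B}"
      then obtain c k t where "z = (F c (k, 0), t)" "c \<in> C" "k \<in> topspace (K c)" "t \<in> {0..1}"
        by (cases z) (auto simp: X_def)
      then show "z \<in> (\<Union>c\<in>C. ?q c ` {z \<in> topspace (?D c). F c z \<in> B})"
        using z \<Phi> by (auto intro!: bexI[of _ c] image_eqI[of _ _ "(k, t)"])
    next
      fix z assume "z \<in> (\<Union>c\<in>C. ?q c ` {z \<in> topspace (?D c). F c z \<in> B})"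
      then show "z \<in> {z \<in> topspace ?P. \<Phi> z \<in> B}"
        using \<Phi> FZ by (auto simp: X_def)
    qed
    also have "closedin ?P \<dots>" using fin q by (intro closedin_Union) auto
    finally show "closedin ?P {z \<in> topspace ?P. \<Phi> z \<in> B}" .
  qed
  have emb: "embedding_map (subtopology Z X) Z (\<lambda>x. \<Phi> (x, t))" if t: "t \<in> {0..1}" for t
  proof (rule continuous_imp_embedding_map[OF _ compX haus])
    have "continuous_map (subtopology Z X) ?P (\<lambda>x. (x, t))"
      using t by (auto intro!: continuous_map_pairedI)
    from continuous_map_compose[OF this cont\<Phi>]
    show "continuous_map (subtopology Z X) Z (\<lambda>x. \<Phi> (x, t))" by (simp add: o_def)
    show "inj_on (\<lambda>x. \<Phi> (x, t)) (topspace (subtopology Z X))"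
    proof (rule inj_onI)
      fix x y assume "x \<in> topspace (subtopology Z X)" "y \<in> topspace (subtopology Z X)"
        and eq: "\<Phi> (x, t) = \<Phi> (y, t)"
      then obtain c k c' k' where "x = F c (k, 0)" "y = F c' (k', 0)" "c \<in> C" "c' \<in> C"
        "k \<in> topspace (K c)" "k' \<in> topspace (K c')" by (auto simp: X_def)
      then show "x = y" using eq \<Phi> t sep[of c c' k k' t 0] by auto
    qed
  qed
  have "(\<lambda>x. \<Phi> (x, 1)) ` X = (\<Union>c\<in>C. (\<lambda>k. F c (k, 1)) ` topspace (K c))"
    using \<Phi> by (auto simp: X_def image_UN image_image)
  moreover have "\<forall>x\<in>X. \<Phi> (x, 0) = x" using \<Phi> by (auto simp: X_def)
  ultimately show ?thesis
    unfolding isotopic_in_def X_def[symmetric] using cont\<Phi> emb by blast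
qed

section \<open>The path metric on a graph\<close>

text \<open>
  The name refers to \<open>on_edge\<close>: as the graph is connected and not a point, the closed edges cover
  it.
\<close>

locale covering_graph =
  fixes G :: "('a, 'e) graph_complex"
  assumes metric: "metric_graph G" and regular: "minimal_regular G"
    and not_point: "\<nexists>p. topspace (gspace G) = {p}"
begin

lemma edge_facts:
  assumes "e \<in> edges G"
  shows "0 < len G e" "continuous_map (top_of_set {0..len G e}) (gspace G) (chart G e)"
    "inj_on (chart G e) {0..len G e}" "chart G e 0 \<in> nodes G" "chart G e (len G e) \<in> nodes G"
    "chart G e ` {0<..<len G e} \<inter> nodes G = {}"
  using metric regular assms by (auto simp: metric_graph_def minimal_regular_def)

lemma chart_in_topspace:
  assumes "e \<in> edges G" "s \<in> {0..len G e}"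
  shows "chart G e s \<in> topspace (gspace G)"
  using continuous_map_image_subset_topspace[OF edge_facts(2)[OF assms(1)]] assms(2) by auto

lemma node_in_topspace: "v \<in> nodes G \<Longrightarrow> v \<in> topspace (gspace G)"
  using metric by (auto simp: metric_graph_def)

lemma chart_node_iff:
  assumes "e \<in> edges G" "s \<in> {0..len G e}"
  shows "chart G e s \<in> nodes G \<longleftrightarrow> s = 0 \<or> s = len G e"
proof (cases "s = 0 \<or> s = len G e")
  case False
  then have "s \<in> {0<..<len G e}" using assms(2) by auto
  then have "chart G e s \<in> chart G e ` {0<..<len G e}" by (rule imageI)
  then show ?thesis using edge_facts(6)[OF assms(1)] False by blast
qed (use edge_facts(4,5)[OF assms(1)] in auto)

text \<open>
  The only identifications between points of edges are at end points; regularity excludes that a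
  chart identifies its two ends.
\<close>

lemma chart_eq_cases:
  assumes "e \<in> edges G" "s \<in> {0..len G e}" "e' \<in> edges G" "t \<in> {0..len G e'}"
    and eq: "chart G e s = chart G e' t"
  shows "(e = e' \<and> s = t) \<or> ((s = 0 \<or> s = len G e) \<and> (t = 0 \<or> t = len G e'))"
proof (cases "chart G e s \<in> nodes G")
  case True
  then show ?thesis using chart_node_iff assms eq by metis
next
  case False
  then have "s \<in> {0<..<len G e}" "t \<in> {0<..<len G e'}"
    using chart_node_iff[OF assms(1,2)] chart_node_iff[OF assms(3,4)] assms(2,4) eq by auto
  moreover have "disjoint_family_on (\<lambda>e. chart G e ` {0<..<len G e}) (edges G)"
    using metric by (simp add: metric_graph_def)
  moreover have "chart G e s \<in> chart G e ` {0<..<len G e} \<inter> chart G e' ` {0<..<len G e'}"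
    using imageI[OF calculation(1), of "chart G e"] imageI[OF calculation(2), of "chart G e'"] eq by simp
  ultimately have "e = e'" using assms(1,3) unfolding disjoint_family_on_def by blast
  moreover from this have "s = t"
    using edge_facts(3)[OF assms(1)] assms(2,4) eq by (auto dest: inj_onD)
  ultimately show ?thesis by simp
qed

lemma edge_path_append:
  "edge_path G x p y \<Longrightarrow> edge_path G y q z \<Longrightarrow> edge_path G x (p @ q) z"
  by (induction G x p y rule: edge_path.induct) auto

lemma path_len_append: "path_len (p @ q) = path_len p + path_len q"
  by (simp add: path_len_def)

lemma path_len_nonneg: "0 \<le> path_len p"
  by (induction p) (auto simp: path_len_def)

lemma edge_path_reverse:
  "edge_path G x p y \<Longrightarrow> \<exists>q. edge_path G y q x \<and> path_len q = path_len p"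
proof (induction p arbitrary: x)
  case Nil
  then show ?case by (intro exI[of _ "[]"]) auto
next
  case (Cons a p)
  obtain e s t where a: "a = (e, s, t)" by (cases a)
  with Cons obtain q where q: "edge_path G y q (chart G e t)" "path_len q = path_len p" by force
  then have "edge_path G y (q @ [(e, t, s)]) x"
    using Cons.prems a by (intro edge_path_append[OF q(1)]) auto
  then show ?case using q a by (intro exI[of _ "q @ [(e, t, s)]"]) (auto simp: path_len_def)
qed

text \<open>
  The nodes and the closed edges are finitely many closed sets, within each of which any two points are
  joined by a path. So a path component and its complement are both closed. This makes \<open>gdist\<close>
  an infimum of a nonempty set.
\<close>

lemma reachable:
  assumes x: "x \<in> topspace (gspace G)" and y: "y \<in> topspace (gspace G)"
  shows "\<exists>p. edge_path G x p y"
proof -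
  define R where "R = {y \<in> topspace (gspace G). \<exists>p. edge_path G x p y}"
  define pieces where "pieces = (\<lambda>v. {v}) ` nodes G \<union> (\<lambda>e. chart G e ` {0..len G e}) ` edges G"
  have haus: "Hausdorff_space (gspace G)" and conn: "connected_space (gspace G)"
    and fin: "finite (nodes G)" "finite (edges G)"
    and top: "topspace (gspace G) = nodes G \<union> (\<Union>e\<in>edges G. chart G e ` {0<..<len G e})"
    using metric by (auto simp: metric_graph_def)
  have closed: "closedin (gspace G) Q" if "Q \<in> pieces" for Q
  proof -
    have "compactin (gspace G) Q"
      using that unfolding pieces_def
    proof (elim UnE imageE)
      fix e assume e: "e \<in> edges G" "Q = chart G e ` {0..len G e}"
      have "compactin (top_of_set {0..len G e}) {0..len G e}" by (simp add: compactin_subtopology)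
      then show ?thesis unfolding e(2) using edge_facts(2)[OF e(1)] by (rule image_compactin)
    qed (use node_in_topspace in auto)
    then show ?thesis using haus compactin_imp_closedin by blast
  qed
  have finp: "finite pieces" using fin by (simp add: pieces_def)
  have cover: "\<Union>pieces = topspace (gspace G)"
  proof
    show "\<Union>pieces \<subseteq> topspace (gspace G)"
      using closed closedin_subset by blast
    show "topspace (gspace G) \<subseteq> \<Union>pieces"
      unfolding top pieces_def by fastforce
  qed
  have inside: "Q \<subseteq> R" if Q: "Q \<in> pieces" "Q \<inter> R \<noteq> {}" for Q
  proof
    fix z assume z: "z \<in> Q"
    obtain u p where u: "u \<in> Q" "edge_path G x p u" using Q(2) by (auto simp: R_def)
    have "\<exists>q. edge_path G u q z"
      using Q(1) unfolding pieces_def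
    proof (elim UnE imageE)
      fix e assume e: "e \<in> edges G" "Q = chart G e ` {0..len G e}"
      then obtain s t where "s \<in> {0..len G e}" "t \<in> {0..len G e}" "u = chart G e s" "z = chart G e t"
        using u(1) z by auto
      then show ?thesis using e(1) by (intro exI[of _ "[(e, s, t)]"]) auto
    qed (use u(1) z in \<open>auto intro!: exI[of _ "[]"]\<close>)
    moreover have "z \<in> topspace (gspace G)" using cover Q(1) z by auto
    ultimately show "z \<in> R" using edge_path_append[OF u(2)] by (auto simp: R_def)
  qed
  have R_top: "R \<subseteq> topspace (gspace G)" by (auto simp: R_def)
  have "closedin (gspace G) R"
  proof -
    have "R = \<Union>{Q \<in> pieces. Q \<inter> R \<noteq> {}}"
    proof
      show "R \<subseteq> \<Union>{Q \<in> pieces. Q \<inter> R \<noteq> {}}" using R_top cover by fast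
      show "\<Union>{Q \<in> pieces. Q \<inter> R \<noteq> {}} \<subseteq> R" using inside by fast
    qed
    also have "closedin (gspace G) \<dots>" using closed finp by (intro closedin_Union) auto
    finally show ?thesis .
  qed
  moreover have "openin (gspace G) R"
  proof -
    have "topspace (gspace G) - R = \<Union>{Q \<in> pieces. Q \<inter> R = {}}"
    proof
      show "topspace (gspace G) - R \<subseteq> \<Union>{Q \<in> pieces. Q \<inter> R = {}}"
        unfolding cover[symmetric] using inside by fast
      show "\<Union>{Q \<in> pieces. Q \<inter> R = {}} \<subseteq> topspace (gspace G) - R"
        unfolding cover[symmetric] by fast
    qed
    also have "closedin (gspace G) \<dots>" using closed finp by (intro closedin_Union) auto
    finally show ?thesis using R_top by (simp add: openin_closedin_eq)
  qed
  moreover have "edge_path G x [] x" by simp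
  then have "x \<in> R" using x unfolding R_def by blast
  ultimately have "R = topspace (gspace G)"
    using conn unfolding connected_space_clopen_in by blast
  then show ?thesis using y by (auto simp: R_def)
qed

lemma on_edge:
  assumes x: "x \<in> topspace (gspace G)"
  shows "\<exists>e\<in>edges G. \<exists>s\<in>{0..len G e}. chart G e s = x"
proof -
  obtain y where y: "y \<in> topspace (gspace G)" "y \<noteq> x" using x not_point by blast
  obtain p where p: "edge_path G x p y" using reachable[OF x y(1)] by blast
  moreover have "p \<noteq> []" using p y(2) by auto
  ultimately obtain e s t q where "p = (e, s, t) # q" by (metis neq_Nil_conv surj_pair)
  then show ?thesis using p by (intro bexI[of _ e] bexI[of _ s]) auto
qed

lemma gdist_le_path_len:
  assumes "edge_path G x p y" shows "gdist G x y \<le> path_len p"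
  unfolding gdist_def using assms path_len_nonneg by (intro cInf_lower bdd_belowI[of _ 0]) auto

lemma gdist_sym: "gdist G x y = gdist G y x"
proof -
  have "{path_len p |p. edge_path G x p y} = {path_len p |p. edge_path G y p x}"
    using edge_path_reverse by (intro set_eqI iffI; clarsimp; metis)
  then show ?thesis by (simp add: gdist_def)
qed

lemma gdist_ge_iff:
  assumes "x \<in> topspace (gspace G)" "y \<in> topspace (gspace G)"
  shows "m \<le> gdist G x y \<longleftrightarrow> (\<forall>p. edge_path G x p y \<longrightarrow> m \<le> path_len p)"
proof
  assume "\<forall>p. edge_path G x p y \<longrightarrow> m \<le> path_len p"
  then show "m \<le> gdist G x y"
    unfolding gdist_def using reachable[OF assms] by (intro cInf_greatest) auto
qed (use gdist_le_path_len in force)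

lemma gdist_refl: "x \<in> topspace (gspace G) \<Longrightarrow> gdist G x x = 0"
  using gdist_le_path_len[of x "[]" x] gdist_ge_iff[of x x 0] path_len_nonneg
  by (auto simp: path_len_def)

lemma gdist_triangle:
  assumes "x \<in> topspace (gspace G)" "y \<in> topspace (gspace G)" "z \<in> topspace (gspace G)"
  shows "gdist G x z \<le> gdist G x y + gdist G y z"
proof -
  have "gdist G x z - path_len p \<le> gdist G y z" if p: "edge_path G x p y" for p
    unfolding gdist_ge_iff[OF assms(2,3)]
    using gdist_le_path_len[OF edge_path_append[OF p]] by (fastforce simp: path_len_append)
  then have "gdist G x z - gdist G y z \<le> gdist G x y"
    unfolding gdist_ge_iff[OF assms(1,2)] by fastforce
  then show ?thesis by simp
qed

lemma gdist_on_edge: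
  assumes "e \<in> edges G" "s \<in> {0..len G e}" "t \<in> {0..len G e}"
  shows "gdist G (chart G e s) (chart G e t) \<le> \<bar>s - t\<bar>"
  using gdist_le_path_len[of "chart G e s" "[(e, s, t)]" "chart G e t"] assms by (simp add: path_len_def)

lemma gdist_through_end0:
  assumes "e \<in> edges G" "s \<in> {0..len G e}" "y \<in> topspace (gspace G)"
  shows "gdist G (chart G e s) y \<le> s + gdist G (end0 G e) y"
  using gdist_triangle[OF chart_in_topspace[OF assms(1,2)] chart_in_topspace[OF assms(1), of 0] assms(3)]
    gdist_on_edge[OF assms(1,2), of 0] edge_facts(1)[OF assms(1)] assms(2) by (auto simp: end0_def)

lemma gdist_through_end1:
  assumes "e \<in> edges G" "s \<in> {0..len G e}" "y \<in> topspace (gspace G)"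
  shows "gdist G (chart G e s) y \<le> len G e - s + gdist G (end1 G e) y"
  using gdist_triangle[OF chart_in_topspace[OF assms(1,2)] chart_in_topspace[OF assms(1), of "len G e"] assms(3)]
    gdist_on_edge[OF assms(1,2), of "len G e"] edge_facts(1)[OF assms(1)] assms(2) by (auto simp: end1_def)

text \<open>
  Induction along the path: as long as it moves on \<open>e\<close> the triangle inequality applies, and it
  can only leave the edge when it is at one of its ends, from where on its length is bounded below by the
  distance from that end.
\<close>

lemma path_leaves_through_end:
  assumes "edge_path G (chart G e s) p y" "e \<in> edges G" "s \<in> {0..len G e}"
  shows "s + gdist G (end0 G e) y \<le> path_len p \<or> len G e - s + gdist G (end1 G e) y \<le> path_len p \<or>
     (\<exists>t\<in>{0..len G e}. y = chart G e t \<and> \<bar>s - t\<bar> \<le> path_len p)"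
  using assms
proof (induction p arbitrary: s)
  case Nil
  then show ?case by (auto simp: path_len_def)
next
  case (Cons a p)
  obtain e1 s1 t1 where a: "a = (e1, s1, t1)" by (cases a)
  have p: "e1 \<in> edges G" "s1 \<in> {0..len G e1}" "t1 \<in> {0..len G e1}" "chart G e1 s1 = chart G e s"
    "edge_path G (chart G e1 t1) p y"
    using Cons.prems(1) a by auto
  have L: "path_len (a # p) = \<bar>s1 - t1\<bar> + path_len p" by (simp add: path_len_def a)
  consider "e1 = e" "s1 = s" | "s = 0" | "s = len G e"
    using chart_eq_cases[OF p(1,2) Cons.prems(2,3) p(4)] by blast
  then show ?case
  proof cases
    case 1
    then have len: "path_len (a # p) = \<bar>s - t1\<bar> + path_len p" and t1: "t1 \<in> {0..len G e}"
      using L p(3) by auto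
    have "t1 + gdist G (end0 G e) y \<le> path_len p \<or> len G e - t1 + gdist G (end1 G e) y \<le> path_len p \<or>
        (\<exists>t\<in>{0..len G e}. y = chart G e t \<and> \<bar>t1 - t\<bar> \<le> path_len p)"
      using Cons.IH[of t1] p(5) Cons.prems(2) t1 1(1) by simp
    then consider "t1 + gdist G (end0 G e) y \<le> path_len p" | "len G e - t1 + gdist G (end1 G e) y \<le> path_len p"
      | t where "t \<in> {0..len G e}" "y = chart G e t" "\<bar>t1 - t\<bar> \<le> path_len p"
      by blast
    then show ?thesis
    proof cases
      case 3
      then have "\<bar>s - t\<bar> \<le> path_len (a # p)" using len by linarith
      then show ?thesis using 3 by blast
    qed (use len in linarith)+
  next
    case 2
    then show ?thesis using gdist_le_path_len[OF Cons.prems(1)] by (simp add: end0_def)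
  next
    case 3
    then show ?thesis using gdist_le_path_len[OF Cons.prems(1)] by (simp add: end1_def)
  qed
qed

lemma gdist_ge_from_edge:
  assumes "e \<in> edges G" "s \<in> {0..len G e}" "y \<in> topspace (gspace G)"
    and "m \<le> s + gdist G (end0 G e) y" "m \<le> len G e - s + gdist G (end1 G e) y"
    and "\<And>t. t \<in> {0..len G e} \<Longrightarrow> y = chart G e t \<Longrightarrow> m \<le> \<bar>s - t\<bar>"
  shows "m \<le> gdist G (chart G e s) y"
  unfolding gdist_ge_iff[OF chart_in_topspace[OF assms(1,2)] assms(3)]
  using path_leaves_through_end[OF _ assms(1,2)] assms(4-6) by fastforce

lemma gdist_ge_node_edge:
  assumes e: "e \<in> edges G" "t \<in> {0..len G e}" and v: "v \<in> nodes G"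
    and "m \<le> t + gdist G v (end0 G e)" "m \<le> len G e - t + gdist G v (end1 G e)"
  shows "m \<le> gdist G v (chart G e t)"
proof -
  note vt = node_in_topspace[OF v]
  have "m \<le> \<bar>t - u\<bar>" if "u \<in> {0..len G e}" "v = chart G e u" for u
  proof -
    have "u = 0 \<or> u = len G e" using chart_node_iff[OF e(1) that(1)] that(2) v by simp
    then have "v = end0 G e \<and> u = 0 \<or> v = end1 G e \<and> u = len G e"
      using that(2) by (auto simp: end0_def end1_def)
    then show ?thesis using gdist_refl[OF vt] assms(4,5) e(2) by auto
  qed
  then have "m \<le> gdist G (chart G e t) v"
    using assms(4,5) by (intro gdist_ge_from_edge[OF e vt]) (simp_all add: gdist_sym)
  then show ?thesis by (simp add: gdist_sym)
qed

lemma end_nodes: "e \<in> edges G \<Longrightarrow> end0 G e \<in> nodes G" "e \<in> edges G \<Longrightarrow> end1 G e \<in> nodes G"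
  using edge_facts by (auto simp: end0_def end1_def)

text \<open>
  A shortest path between two different edges leaves the first through one of its ends and enters
  the second through one of its ends.
\<close>

lemma gdist_ge_distinct_edges_iff:
  assumes e: "e \<in> edges G" "s \<in> {0..len G e}" and e': "e' \<in> edges G" "t \<in> {0..len G e'}" and ne: "e \<noteq> e'"
  shows "m \<le> gdist G (chart G e s) (chart G e' t) \<longleftrightarrow>
     m \<le> s + t + gdist G (end0 G e) (end0 G e') \<and>
     m \<le> s + (len G e' - t) + gdist G (end0 G e) (end1 G e') \<and>
     m \<le> (len G e - s) + t + gdist G (end1 G e) (end0 G e') \<and>
     m \<le> (len G e - s) + (len G e' - t) + gdist G (end1 G e) (end1 G e')" (is "_ \<longleftrightarrow> ?R")
proof
  let ?y = "chart G e' t"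
  note y = chart_in_topspace[OF e']
  note ends = node_in_topspace[OF end_nodes(1)[OF e(1)]] node_in_topspace[OF end_nodes(2)[OF e(1)]]
  note up = gdist_through_end0[OF e y] gdist_through_end1[OF e y]
    gdist_through_end0[OF e' ends(1)] gdist_through_end1[OF e' ends(1)]
    gdist_through_end0[OF e' ends(2)] gdist_through_end1[OF e' ends(2)]
  show "m \<le> gdist G (chart G e s) ?y \<Longrightarrow> ?R"
    using up gdist_sym[of ?y] gdist_sym[of "end0 G e'"] gdist_sym[of "end1 G e'"] by auto
  assume R: ?R
  show "m \<le> gdist G (chart G e s) ?y"
  proof (rule gdist_ge_from_edge[OF e y])
    have "m - s \<le> gdist G (end0 G e) ?y" "m - (len G e - s) \<le> gdist G (end1 G e) ?y"
      using R by (auto intro!: gdist_ge_node_edge[OF e'] end_nodes e)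
    then show "m \<le> s + gdist G (end0 G e) ?y" "m \<le> len G e - s + gdist G (end1 G e) ?y" by auto
    fix u assume u: "u \<in> {0..len G e}" "?y = chart G e u"
    have c: "u = 0 \<or> u = len G e" "t = 0 \<or> t = len G e'"
      using chart_eq_cases[OF e' e(1) u] ne by auto
    then show "m \<le> \<bar>s - u\<bar>"
      using R u(2) e(2) gdist_refl[OF ends(1)] gdist_refl[OF ends(2)]
      by (auto simp: end0_def end1_def)
  qed
qed

text \<open>
  Besides the path within the edge, only the one leaving through \<open>end0\<close> and returning
  through \<open>end1\<close> can be shortest, as \<open>s \<le> t\<close>.
\<close>

lemma gdist_ge_same_edge_iff:
  assumes e: "e \<in> edges G" "s \<in> {0..len G e}" "t \<in> {0..len G e}" and st: "s \<le> t"
  shows "m \<le> gdist G (chart G e s) (chart G e t) \<longleftrightarrow>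
     m \<le> t - s \<and> m \<le> s + (len G e - t) + gdist G (end0 G e) (end1 G e)" (is "_ \<longleftrightarrow> ?R")
proof
  let ?y = "chart G e t"
  note y = chart_in_topspace[OF e(1,3)]
  note ends = node_in_topspace[OF end_nodes(1)[OF e(1)]] node_in_topspace[OF end_nodes(2)[OF e(1)]]
  show "m \<le> gdist G (chart G e s) ?y \<Longrightarrow> ?R"
    using gdist_on_edge[OF e] gdist_through_end0[OF e(1,2) y] gdist_through_end1[OF e(1,3) ends(1)]
      gdist_sym[of ?y] gdist_sym[of "end1 G e"] st by auto
  assume R: ?R
  show "m \<le> gdist G (chart G e s) ?y"
  proof (rule gdist_ge_from_edge[OF e(1,2) y])
    have "m - s \<le> gdist G (end0 G e) ?y" "m - (len G e - s) \<le> gdist G (end1 G e) ?y"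
      using R e st gdist_refl[OF ends(1)] gdist_refl[OF ends(2)] gdist_sym[of "end1 G e" "end0 G e"]
      by (auto intro!: gdist_ge_node_edge[OF e(1,3)] end_nodes)
    then show "m \<le> s + gdist G (end0 G e) ?y" "m \<le> len G e - s + gdist G (end1 G e) ?y" by auto
    fix u assume u: "u \<in> {0..len G e}" "?y = chart G e u"
    then have "u = t" using edge_facts(3)[OF e(1)] e(3) by (auto dest: inj_onD)
    then show "m \<le> \<bar>s - u\<bar>" using R st by auto
  qed
qed

end

section \<open>Cells of the power of a graph\<close>

definition in_cell :: "('a, 'e) graph_complex \<Rightarrow> ('n::{finite,linorder}, 'e) max_cell \<Rightarrow> real^('n::{finite,linorder}) \<Rightarrow> bool" where
  "in_cell G c x \<longleftrightarrow> (\<forall>i. x $ i \<in> {0..len G (fst c i)}) \<and>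
     (\<forall>i j. i \<noteq> j \<and> fst c i = fst c j \<and> (i, j) \<in> snd c (fst c i) \<longrightarrow> x $ i \<le> x $ j)"

definition point_of :: "('a, 'e) graph_complex \<Rightarrow> ('n::{finite,linorder}, 'e) max_cell \<Rightarrow> real^('n::{finite,linorder}) \<Rightarrow> 'n \<Rightarrow> 'a" where
  "point_of G c x = (\<lambda>i. chart G (fst c i) (x $ i))"

definition cell_polytope ::
  "('a, 'e) graph_complex \<Rightarrow> ('n::{finite,linorder}, 'e) max_cell \<Rightarrow> ('n \<Rightarrow> 'n \<Rightarrow> real) \<Rightarrow> (real^('n::{finite,linorder})) set" where
  "cell_polytope G c r = halfspaces (cell_labels c) label_row (label_rhs G (fst c) r)"

text \<open>
  The inequalities of the cell itself that are active at \<open>x\<close>; they describe the smallest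
  face of the cell containing \<open>x\<close>. Their right-hand sides do not depend on the parameters, so
  that the value \<open>0\<close> inserted for these is arbitrary.
\<close>

definition face_tight ::
  "('a, 'e) graph_complex \<Rightarrow> ('n::{finite,linorder}, 'e) max_cell \<Rightarrow> real^('n::{finite,linorder}) \<Rightarrow> 'n label set" where
  "face_tight G c x = {l\<in>face_labels c. label_row l \<bullet> x = label_rhs G (fst c) (\<lambda>_ _. 0) l}"

lemma ball_cell_labels:
  "(\<forall>l\<in>cell_labels c. P l) \<longleftrightarrow> (\<forall>i. P (C1 i) \<and> P (C2 i)) \<and>
     (\<forall>i j. i < j \<and> fst c i \<noteq> fst c j \<longrightarrow> P (D1 i j) \<and> P (D2 i j) \<and> P (D3 i j) \<and> P (D4 i j)) \<and>
     (\<forall>i j. i \<noteq> j \<and> fst c i = fst c j \<and> (i, j) \<in> snd c (fst c i) \<longrightarrow> P (E1 i j) \<and> P (E2 i j) \<and> P (E3 i j))"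
  unfolding cell_labels_def case_prod_unfold ball_Un by auto

lemma face_labels_eq:
  "face_labels c = range C1 \<union> range C2 \<union>
     {E1 i j |i j. i \<noteq> j \<and> fst c i = fst c j \<and> (i, j) \<in> snd c (fst c i)}"
  unfolding face_labels_def cell_labels_def case_prod_unfold by auto

lemma ball_face_labels:
  "(\<forall>l\<in>face_labels c. P l) \<longleftrightarrow> (\<forall>i. P (C1 i) \<and> P (C2 i)) \<and>
     (\<forall>i j. i \<noteq> j \<and> fst c i = fst c j \<and> (i, j) \<in> snd c (fst c i) \<longrightarrow> P (E1 i j))"
  unfolding face_labels_eq ball_Un by auto

lemma finite_cell_labels: "finite (cell_labels (c :: ('n::{finite,linorder}, 'e) max_cell))"
  unfolding cell_labels_def case_prod_unfold by (intro finite_UnI finite_UN_I) auto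

lemma label_rhs_face:
  "l \<in> face_labels c \<Longrightarrow> label_rhs G (fst c) r l = label_rhs G (fst c) (\<lambda>_ _. 0) l"
  by (auto simp: face_labels_eq)

lemma inner_label_row:
  fixes x :: "real^'n::finite"
  shows "label_row (C1 i) \<bullet> x = - x $ i" "label_row (C2 i) \<bullet> x = x $ i"
    "label_row (D1 i j) \<bullet> x = - x $ i - x $ j" "label_row (D2 i j) \<bullet> x = - x $ i + x $ j"
    "label_row (D3 i j) \<bullet> x = x $ i - x $ j" "label_row (D4 i j) \<bullet> x = x $ i + x $ j"
    "label_row (E1 i j) \<bullet> x = x $ i - x $ j" "label_row (E2 i j) \<bullet> x = x $ i - x $ j"
    "label_row (E3 i j) \<bullet> x = - x $ i + x $ j"
  by (simp_all add: inner_add_left inner_diff_left inner_axis')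

lemma tight_contains_face_tight_iff:
  "face_tight G c x \<subseteq> tight (cell_labels c) label_row (label_rhs G (fst c) r) z \<longleftrightarrow>
   face_tight G c x \<subseteq> face_tight G c z"
proof -
  have "l \<in> tight (cell_labels c) label_row (label_rhs G (fst c) r) z \<longleftrightarrow> l \<in> face_tight G c z"
    if "l \<in> face_labels c" for l
    using that label_rhs_face[OF that, of G r] by (auto simp: tight_def face_tight_def face_labels_def)
  moreover have "face_tight G c x \<subseteq> face_labels c" by (auto simp: face_tight_def)
  ultimately show ?thesis by blast
qed

lemma face_tight_subset_iff:
  "face_tight G c x \<subseteq> face_tight G c z \<longleftrightarrow>
     (\<forall>i. (x $ i = 0 \<longrightarrow> z $ i = 0) \<and> (x $ i = len G (fst c i) \<longrightarrow> z $ i = len G (fst c i))) \<and>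
     (\<forall>i j. i \<noteq> j \<and> fst c i = fst c j \<and> (i, j) \<in> snd c (fst c i) \<longrightarrow> x $ i = x $ j \<longrightarrow> z $ i = z $ j)"
proof -
  have "face_tight G c x \<subseteq> face_tight G c z \<longleftrightarrow>
    (\<forall>l\<in>face_labels c. label_row l \<bullet> x = label_rhs G (fst c) (\<lambda>_ _. 0) l \<longrightarrow>
        label_row l \<bullet> z = label_rhs G (fst c) (\<lambda>_ _. 0) l)"
    by (auto simp: face_tight_def)
  also have "\<dots> \<longleftrightarrow> (\<forall>i. (x $ i = 0 \<longrightarrow> z $ i = 0) \<and> (x $ i = len G (fst c i) \<longrightarrow> z $ i = len G (fst c i))) \<and>
     (\<forall>i j. i \<noteq> j \<and> fst c i = fst c j \<and> (i, j) \<in> snd c (fst c i) \<longrightarrow> x $ i = x $ j \<longrightarrow> z $ i = z $ j)"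
    unfolding ball_face_labels inner_label_row label_rhs.simps by simp
  finally show ?thesis .
qed

lemma max_cellsD:
  assumes "c \<in> max_cells G"
  shows "fst c i \<in> edges G"
    and "\<lbrakk>fst c i = fst c j; i \<noteq> j\<rbrakk> \<Longrightarrow> (i, j) \<in> snd c (fst c i) \<or> (j, i) \<in> snd c (fst c i)"
proof -
  have c: "\<forall>i. fst c i \<in> edges G" "\<forall>e\<in>edges G. linear_order_on {i. fst c i = e} (snd c e)"
    using assms by (auto simp: max_cells_def)
  then show "fst c i \<in> edges G" by simp
  assume "fst c i = fst c j" "i \<noteq> j"
  moreover have "total_on {k. fst c k = fst c i} (snd c (fst c i))"
    using c by (simp add: linear_order_on_def)
  ultimately show "(i, j) \<in> snd c (fst c i) \<or> (j, i) \<in> snd c (fst c i)"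
    by (simp add: total_on_def)
qed

context covering_graph
begin

text \<open>
  For \<open>D\<close> labels the four inequalities are the four routes between distinct edges, and for
  \<open>E\<close> labels the two routes between points of one edge. As \<open>\<rho>\<close> is total, each pair of coordinates
  on one edge is covered, in one of the two orders; the symmetry of \<open>r\<close> removes the
  dependence on which.
\<close>

lemma cell_polytope_iff:
  fixes r :: "'n::{finite,linorder} \<Rightarrow> 'n \<Rightarrow> real"
  assumes c: "c \<in> max_cells G" and r: "r \<in> param_space"
  shows "x \<in> cell_polytope G c r \<longleftrightarrow> in_cell G c x \<and> point_of G c x \<in> conf_space G r"
proof -
  note edge = max_cellsD(1)[OF c] and total = max_cellsD(2)[OF c]
  have rsym: "r i j = r j i" if "i \<noteq> j" for i j using r that by (auto simp: param_space_def)
  let ?\<epsilon> = "fst c"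
  let ?D = "\<lambda>i j. r i j \<le> x $ i + x $ j + gdist G (end0 G (?\<epsilon> i)) (end0 G (?\<epsilon> j)) \<and>
     r i j \<le> x $ i + (len G (?\<epsilon> j) - x $ j) + gdist G (end0 G (?\<epsilon> i)) (end1 G (?\<epsilon> j)) \<and>
     r i j \<le> (len G (?\<epsilon> i) - x $ i) + x $ j + gdist G (end1 G (?\<epsilon> i)) (end0 G (?\<epsilon> j)) \<and>
     r i j \<le> (len G (?\<epsilon> i) - x $ i) + (len G (?\<epsilon> j) - x $ j) + gdist G (end1 G (?\<epsilon> i)) (end1 G (?\<epsilon> j))"
  let ?E = "\<lambda>i j. r i j \<le> x $ j - x $ i \<and>
     r i j \<le> x $ i + (len G (?\<epsilon> i) - x $ j) + gdist G (end0 G (?\<epsilon> i)) (end1 G (?\<epsilon> i))"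
  have poly: "x \<in> cell_polytope G c r \<longleftrightarrow> in_cell G c x \<and>
     (\<forall>i j. i < j \<and> ?\<epsilon> i \<noteq> ?\<epsilon> j \<longrightarrow> ?D i j) \<and>
     (\<forall>i j. i \<noteq> j \<and> ?\<epsilon> i = ?\<epsilon> j \<and> (i, j) \<in> snd c (?\<epsilon> i) \<longrightarrow> ?E i j)"
  proof -
    have "x \<in> cell_polytope G c r \<longleftrightarrow>
        (\<forall>i. 0 \<le> x $ i \<and> x $ i \<le> len G (?\<epsilon> i)) \<and>
        (\<forall>i j. i < j \<and> ?\<epsilon> i \<noteq> ?\<epsilon> j \<longrightarrow> ?D i j) \<and>
        (\<forall>i j. i \<noteq> j \<and> ?\<epsilon> i = ?\<epsilon> j \<and> (i, j) \<in> snd c (?\<epsilon> i) \<longrightarrow> x $ i \<le> x $ j \<and> ?E i j)"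
      unfolding cell_polytope_def halfspaces_def mem_Collect_eq ball_cell_labels inner_label_row label_rhs.simps
      by (intro arg_cong2[where f = "(\<and>)"] all_cong1 imp_cong refl; linarith)
    then show ?thesis unfolding in_cell_def by auto
  qed
  show ?thesis
  proof (cases "in_cell G c x")
    case False
    then show ?thesis using poly by simp
  next
    case True
    then have rng: "\<And>i. x $ i \<in> {0..len G (?\<epsilon> i)}"
      and ord: "\<And>i j. i \<noteq> j \<Longrightarrow> ?\<epsilon> i = ?\<epsilon> j \<Longrightarrow> (i, j) \<in> snd c (?\<epsilon> i) \<Longrightarrow> x $ i \<le> x $ j"
      by (auto simp: in_cell_def)
    let ?d = "\<lambda>i j. gdist G (point_of G c x i) (point_of G c x j)"
    have D: "?D i j \<longleftrightarrow> r i j \<le> ?d i j" if "?\<epsilon> i \<noteq> ?\<epsilon> j" for i j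
      using gdist_ge_distinct_edges_iff[OF edge rng edge rng that] by (simp add: point_of_def)
    have E: "?E i j \<longleftrightarrow> r i j \<le> ?d i j" if "i \<noteq> j" "?\<epsilon> i = ?\<epsilon> j" "(i, j) \<in> snd c (?\<epsilon> i)" for i j
    proof -
      have "x $ j \<in> {0..len G (?\<epsilon> i)}" using rng[of j] that(2) by simp
      from gdist_ge_same_edge_iff[OF edge rng this ord[OF that], of "r i j"] show ?thesis
        using that(2) by (simp add: point_of_def)
    qed
    have "point_of G c x \<in> topspace (gpower G)"
      using chart_in_topspace[OF edge rng] by (auto simp: gpower_def point_of_def)
    then have conf: "point_of G c x \<in> conf_space G r \<longleftrightarrow> (\<forall>i j. i < j \<longrightarrow> r i j \<le> ?d i j)"
      by (simp add: conf_space_def)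
    have dsym: "?d i j = ?d j i" for i j by (rule gdist_sym)
    show ?thesis
      unfolding poly conf
    proof (intro iffI conjI allI impI True; (elim conjE)?)
      fix i j :: 'n assume ij: "i < j"
        and hD: "\<forall>i j. i < j \<and> ?\<epsilon> i \<noteq> ?\<epsilon> j \<longrightarrow> ?D i j"
        and hE: "\<forall>i j. i \<noteq> j \<and> ?\<epsilon> i = ?\<epsilon> j \<and> (i, j) \<in> snd c (?\<epsilon> i) \<longrightarrow> ?E i j"
      show "r i j \<le> ?d i j"
      proof (cases "?\<epsilon> i = ?\<epsilon> j")
        case False
        then show ?thesis using hD ij D[of i j] by blast
      next
        case same: True
        have ne: "i \<noteq> j" using ij by simp
        from total[OF same ne] show ?thesis
        proof
          assume "(i, j) \<in> snd c (?\<epsilon> i)"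
          then show ?thesis using hE E[of i j] same ne by blast
        next
          assume "(j, i) \<in> snd c (?\<epsilon> i)"
          then have "r j i \<le> ?d j i" using hE[rule_format, of j i] E[of j i] same ne by auto
          then show ?thesis using rsym[OF ne] dsym[of i j] by simp
        qed
      qed
    next
      fix i j :: 'n assume h: "\<forall>i j. i < j \<longrightarrow> r i j \<le> ?d i j" and ij: "i < j" "?\<epsilon> i \<noteq> ?\<epsilon> j"
      then have "?D i j" using D[of i j] by blast
      then show "r i j \<le> x $ i + x $ j + gdist G (end0 G (?\<epsilon> i)) (end0 G (?\<epsilon> j))"
        "r i j \<le> x $ i + (len G (?\<epsilon> j) - x $ j) + gdist G (end0 G (?\<epsilon> i)) (end1 G (?\<epsilon> j))"
        "r i j \<le> (len G (?\<epsilon> i) - x $ i) + x $ j + gdist G (end1 G (?\<epsilon> i)) (end0 G (?\<epsilon> j))"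
        "r i j \<le> (len G (?\<epsilon> i) - x $ i) + (len G (?\<epsilon> j) - x $ j) + gdist G (end1 G (?\<epsilon> i)) (end1 G (?\<epsilon> j))"
        by auto
    next
      fix i j :: 'n assume h: "\<forall>i j. i < j \<longrightarrow> r i j \<le> ?d i j"
        and ij: "i \<noteq> j" "?\<epsilon> i = ?\<epsilon> j" "(i, j) \<in> snd c (?\<epsilon> i)"
      have "r i j \<le> ?d i j"
      proof (cases "i < j")
        case False
        then have "r j i \<le> ?d j i" using h ij(1) by (simp add: not_less_iff_gr_or_eq)
        then show ?thesis using rsym[OF ij(1)] dsym[of i j] by simp
      qed (use h in blast)
      then have "?E i j" using E[OF ij] by blast
      then show "r i j \<le> x $ j - x $ i"
        "r i j \<le> x $ i + (len G (?\<epsilon> i) - x $ j) + gdist G (end0 G (?\<epsilon> i)) (end1 G (?\<epsilon> i))"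
        by auto
    qed
  qed
qed

lemma compact_cell_polytope:
  fixes r :: "'n::{finite,linorder} \<Rightarrow> 'n \<Rightarrow> real"
  assumes "c \<in> max_cells G" "r \<in> param_space"
  shows "compact (cell_polytope G c r)"
proof -
  have "closed (cell_polytope G c r)"
  proof -
    have "cell_polytope G c r = (\<Inter>l\<in>cell_labels c. {y. label_row l \<bullet> y \<le> label_rhs G (fst c) r l})"
      by (auto simp: cell_polytope_def halfspaces_def)
    then show ?thesis by (simp only:) (intro closed_INT ballI closed_halfspace_le)
  qed
  moreover have "cell_polytope G c r \<subseteq> cbox 0 (\<chi> i. len G (fst c i))"
    using cell_polytope_iff[OF assms] by (auto simp: in_cell_def mem_box_cart)
  ultimately show ?thesis
    using bounded_subset[OF bounded_cbox] compact_eq_bounded_closed by blast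
qed

text \<open>
  The order on the coordinates of an edge is that of their parameters, ties being broken by the order
  of the indices. A maximal cell may have arbitrary orders attached to elements that are not edges;
  taking these empty leaves only finitely many cells, which still cover the product.
\<close>

lemma cell_containing_point:
  assumes \<xi>: "\<xi> \<in> topspace (gpower G :: ('n::{finite,linorder} \<Rightarrow> 'a) topology)"
  shows "\<exists>c\<in>max_cells G. (\<forall>e. e \<notin> edges G \<longrightarrow> snd c e = {}) \<and> (\<exists>x. in_cell G c x \<and> point_of G c x = \<xi>)"
proof -
  have "\<forall>i. \<exists>e s. e \<in> edges G \<and> s \<in> {0..len G e} \<and> chart G e s = \<xi> i"
    using on_edge \<xi> by (fastforce simp: gpower_def)
  then obtain \<epsilon> s where s: "\<And>i. \<epsilon> i \<in> edges G" "\<And>i. s i \<in> {0..len G (\<epsilon> i)}"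
    "\<And>i. chart G (\<epsilon> i) (s i) = \<xi> i" by metis
  define \<rho> where "\<rho> = (\<lambda>e. {(i, j). \<epsilon> i = e \<and> \<epsilon> j = e \<and> (s i < s j \<or> s i = s j \<and> i \<le> j)})"
  have "linear_order_on {i. \<epsilon> i = e} (\<rho> e)" for e
    unfolding linear_order_on_def partial_order_on_def preorder_on_def
  proof (intro conjI)
    show "\<rho> e \<subseteq> {i. \<epsilon> i = e} \<times> {i. \<epsilon> i = e}" by (auto simp: \<rho>_def)
    show "refl_on {i. \<epsilon> i = e} (\<rho> e)" by (rule refl_onI) (simp add: \<rho>_def)
    show "trans (\<rho> e)" unfolding \<rho>_def by (rule transI) (clarsimp; elim disjE conjE; simp)
    show "antisym (\<rho> e)" unfolding \<rho>_def by (rule antisymI) (clarsimp; elim disjE conjE; simp)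
    show "total_on {i. \<epsilon> i = e} (\<rho> e)" unfolding total_on_def \<rho>_def by (simp; meson linear linorder_less_linear)
  qed
  then have "(\<epsilon>, \<rho>) \<in> max_cells G" using s(1) by (simp add: max_cells_def)
  moreover have "\<forall>e. e \<notin> edges G \<longrightarrow> \<rho> e = {}" using s(1) by (auto simp: \<rho>_def)
  moreover have "in_cell G (\<epsilon>, \<rho>) (\<chi> i. s i)" using s(2) by (auto simp: in_cell_def \<rho>_def)
  moreover have "point_of G (\<epsilon>, \<rho>) (\<chi> i. s i) = \<xi>" using s(3) by (auto simp: point_of_def)
  ultimately show ?thesis by (intro bexI[of _ "(\<epsilon>, \<rho>)"]) auto
qed

text \<open>
  Let \<open>x\<close> and \<open>x'\<close> describe the same point. Coordinates in the interior of an edge agree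
  in both cells, and all points \<open>z\<close> of the smallest face containing \<open>x\<close> share with \<open>x\<close> its
  coordinates at end points. So passing to the other cell adds the constant vector \<open>x' - x\<close>.
  The orders in the two cells can only differ for coordinates that coincide at \<open>x\<close>, and these
  coincide on the whole face.
\<close>

lemma face_in_neighbouring_cell:
  fixes x x' z :: "real^'n::{finite,linorder}"
  assumes c: "c \<in> max_cells G" "c' \<in> max_cells G" and x: "in_cell G c x" "in_cell G c' x'"
    and eq: "point_of G c x = point_of G c' x'"
    and z: "in_cell G c z" "face_tight G c x \<subseteq> face_tight G c z"
  defines "z' \<equiv> z + (x' - x)"
  shows "in_cell G c' z'" "face_tight G c' x' \<subseteq> face_tight G c' z'" "point_of G c' z' = point_of G c z"
proof -
  have rng: "x $ i \<in> {0..len G (fst c i)}" "x' $ i \<in> {0..len G (fst c' i)}" "z $ i \<in> {0..len G (fst c i)}" for i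
    using x z(1) by (auto simp: in_cell_def)
  have zc: "z' $ i = z $ i + (x' $ i - x $ i)" for i by (simp add: z'_def)
  have keep: "x $ i = 0 \<Longrightarrow> z $ i = 0" "x $ i = len G (fst c i) \<Longrightarrow> z $ i = len G (fst c i)" for i
    using z(2) by (auto simp: face_tight_subset_iff)
  have keepE: "z $ i = z $ j"
    if "i \<noteq> j" "fst c i = fst c j" "(i, j) \<in> snd c (fst c i)" "x $ i = x $ j" for i j
    using z(2) that by (auto simp: face_tight_subset_iff)
  have dich: "(fst c i = fst c' i \<and> x $ i = x' $ i) \<or>
     ((x $ i = 0 \<or> x $ i = len G (fst c i)) \<and> (x' $ i = 0 \<or> x' $ i = len G (fst c' i)))" for i
    using chart_eq_cases[OF max_cellsD(1)[OF c(1)] rng(1) max_cellsD(1)[OF c(2)] rng(2)] fun_cong[OF eq, of i]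
    by (simp add: point_of_def)
  have endpt: "z' $ i = x' $ i" if "x' $ i = 0 \<or> x' $ i = len G (fst c' i)" for i
    using dich[of i] keep[of i] that zc[of i] by auto
  have inner: "fst c i = fst c' i" "x $ i = x' $ i" "z' $ i = z $ i"
    if "\<not> (x' $ i = 0 \<or> x' $ i = len G (fst c' i))" for i
    using dich[of i] that zc[of i] by auto
  have rng': "z' $ i \<in> {0..len G (fst c' i)}" for i
    using endpt[of i] inner[of i] rng[of i] by (cases "x' $ i = 0 \<or> x' $ i = len G (fst c' i)") auto
  have E: "z' $ i \<le> z' $ j \<and> (x' $ i = x' $ j \<longrightarrow> z' $ i = z' $ j)"
    if ij: "i \<noteq> j" "fst c' i = fst c' j" "(i, j) \<in> snd c' (fst c' i)" for i j
  proof -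
    have le: "x' $ i \<le> x' $ j" using x(2) ij by (auto simp: in_cell_def)
    show ?thesis
    proof (cases "(x' $ i = 0 \<or> x' $ i = len G (fst c' i)) \<or> (x' $ j = 0 \<or> x' $ j = len G (fst c' j))")
      case True
      then show ?thesis
        using endpt[of i] endpt[of j] le rng(2)[of i] rng(2)[of j] rng'[of i] rng'[of j] ij(2) by auto
    next
      case False
      then have i: "fst c i = fst c' i" "x $ i = x' $ i" "z' $ i = z $ i"
        and j: "fst c j = fst c' j" "x $ j = x' $ j" "z' $ j = z $ j"
        using inner[of i] inner[of j] by auto
      have same: "fst c i = fst c j" using i(1) j(1) ij(2) by simp
      from max_cellsD(2)[OF c(1) same ij(1)] show ?thesis
      proof
        assume o: "(i, j) \<in> snd c (fst c i)"
        then have "z $ i \<le> z $ j" using z(1) ij(1) same by (auto simp: in_cell_def)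
        then show ?thesis using keepE[OF ij(1) same o] i j by simp
      next
        assume "(j, i) \<in> snd c (fst c i)"
        then have o: "(j, i) \<in> snd c (fst c j)" using same by simp
        then have "x $ j \<le> x $ i" using x(1) ij(1) same by (auto simp: in_cell_def)
        then have "x $ j = x $ i" using le i j by simp
        then show ?thesis using keepE[OF ij(1)[symmetric] same[symmetric] o] i j by simp
      qed
    qed
  qed
  show "in_cell G c' z'" unfolding in_cell_def using rng' E by blast
  show "face_tight G c' x' \<subseteq> face_tight G c' z'"
    unfolding face_tight_subset_iff using endpt E by auto
  show "point_of G c' z' = point_of G c z"
  proof
    fix i
    show "point_of G c' z' i = point_of G c z i"
    proof (cases "x' $ i = 0 \<or> x' $ i = len G (fst c' i)")
      case True
      then have "z' $ i = x' $ i" by (rule endpt)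
      moreover have "fst c i = fst c' i \<and> z $ i = x' $ i \<or> z $ i = x $ i"
        using dich[of i] keep[of i] True by auto
      ultimately show ?thesis using fun_cong[OF eq, of i] by (auto simp: point_of_def)
    next
      case False
      then show ?thesis using inner[of i] by (simp add: point_of_def)
    qed
  qed
qed

lemma translates_face_cells:
  fixes x x' :: "real^'n::{finite,linorder}"
  assumes c: "c \<in> max_cells G" "c' \<in> max_cells G" and x: "in_cell G c x" "in_cell G c' x'"
    and eq: "point_of G c x = point_of G c' x'" and r: "r \<in> param_space"
  shows "translates_face (cell_labels c) label_row (label_rhs G (fst c) r) (face_tight G c x) (x' - x)
     (cell_labels c') label_row (label_rhs G (fst c') r) (face_tight G c' x')"
  unfolding translates_face_def tight_contains_face_tight_iff cell_polytope_def[symmetric]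
    cell_polytope_iff[OF c(1) r] cell_polytope_iff[OF c(2) r]
proof (intro allI iffI)
  fix z :: "real^('n::{finite,linorder})"
  assume "(in_cell G c z \<and> point_of G c z \<in> conf_space G r) \<and> face_tight G c x \<subseteq> face_tight G c z"
  then show "(in_cell G c' (z + (x' - x)) \<and> point_of G c' (z + (x' - x)) \<in> conf_space G r) \<and>
      face_tight G c' x' \<subseteq> face_tight G c' (z + (x' - x))"
    using face_in_neighbouring_cell[OF c x eq, of z] by simp
next
  fix z :: "real^('n::{finite,linorder})"
  assume "(in_cell G c' (z + (x' - x)) \<and> point_of G c' (z + (x' - x)) \<in> conf_space G r) \<and>
      face_tight G c' x' \<subseteq> face_tight G c' (z + (x' - x))"
  then show "(in_cell G c z \<and> point_of G c z \<in> conf_space G r) \<and> face_tight G c x \<subseteq> face_tight G c z"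
    using face_in_neighbouring_cell[OF c(2,1) x(2,1) eq[symmetric], of "z + (x' - x)"] by simp
qed

end

lemma finite_cell_representatives:
  assumes "finite (edges G)"
  shows "finite {c \<in> max_cells G :: ('n::{finite,linorder}, 'e) max_cell set. \<forall>e. e \<notin> edges G \<longrightarrow> snd c e = {}}"
proof -
  have "finite {f :: 'n \<Rightarrow> 'e. \<forall>i. (i \<in> UNIV \<longrightarrow> f i \<in> edges G) \<and> (i \<notin> UNIV \<longrightarrow> f i = undefined)}"
    using assms by (intro finite_set_of_finite_funs) auto
  moreover have "finite {f :: 'e \<Rightarrow> ('n \<times> 'n) set. \<forall>e. (e \<in> edges G \<longrightarrow> f e \<in> UNIV) \<and> (e \<notin> edges G \<longrightarrow> f e = {})}"
    using assms by (intro finite_set_of_finite_funs) auto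
  ultimately show ?thesis
    by (rule finite_subset[OF _ finite_cartesian_product, rotated]) (auto simp: max_cells_def)
qed

section \<open>Isotopy of configuration spaces of the same type\<close>

theorem theorem3p2:
  fixes G :: "('a, 'e) graph_complex"
    and r s :: "'n::{finite,linorder} \<Rightarrow> 'n \<Rightarrow> real"
  assumes "metric_graph G" and "minimal_regular G"
    and "\<nexists>p. topspace (gspace G) = {p}"
    and "\<not> gspace G homeomorphic_space top_of_set {0..1::real}"
    and "\<not> gspace G homeomorphic_space top_of_set (sphere (0::complex) 1)"
    and "CARD('n) \<ge> 2"
    and "r \<in> param_space" and "s \<in> param_space"
    and "param_equiv G r s"
  shows "isotopic_in (gpower G) (conf_space G r) (conf_space G s)"
proof -
  interpret covering_graph G by unfold_locales (use assms(1-3) in auto)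
  note rs = assms(7,8)
  \<comment> \<open>Finitely many cells suffice to cover the product.\<close>
  define C :: "('n, 'e) max_cell set" where "C = {c \<in> max_cells G. \<forall>e. e \<notin> edges G \<longrightarrow> snd c e = {}}"
  define T where "T = (\<lambda>c :: ('n, 'e) max_cell. max_cell_type G c r)"
  define P where "P = (\<lambda>(c :: ('n, 'e) max_cell) u w.
    \<Sum>v\<in>T c. w v *\<^sub>R vertex_of (cell_labels c) label_row (label_rhs G (fst c) u) v)"
  define Q where "Q = (\<lambda>c w t. (1 - t) *\<^sub>R P c r w + t *\<^sub>R P c s w)"
  define F where "F = (\<lambda>c (w, t). point_of G c (Q c w t))"
  define K where "K = (\<lambda>c. top_of_set (face_weights (T c)))"
  have C: "c \<in> max_cells G" if "c \<in> C" for c using that by (simp add: C_def)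
  have Tr: "polytope_type (cell_labels c) label_row (label_rhs G (fst c) r) = T c" for c
    by (simp add: T_def max_cell_type_def)
  have Ts: "polytope_type (cell_labels c) label_row (label_rhs G (fst c) s) = T c" if "c \<in> C" for c
    using assms(9) C[OF that] by (simp add: T_def max_cell_type_def param_equiv_iff_max_cells)
  have finT: "finite (T c)" for c
    using finite_polytope_type[OF finite_cell_labels] Tr by metis
  have wts: "0 \<le> w v" "sum w (T c) = 1" "w v \<noteq> 0 \<Longrightarrow> v \<in> T c" if "w \<in> face_weights (T c)" for w v c
    using that quasiconcave_support by (auto simp: face_weights_def quasiconcave_def)
  have Pr: "P c r w \<in> cell_polytope G c r" and Ps: "P c s w \<in> cell_polytope G c s"
    and tight: "l \<in> tight (cell_labels c) label_row (label_rhs G (fst c) r) (P c r w) \<longleftrightarrow> l \<in> cell_labels c \<and> (\<forall>v. w v \<noteq> 0 \<longrightarrow> l \<in> v)"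
      "l \<in> tight (cell_labels c) label_row (label_rhs G (fst c) s) (P c s w) \<longleftrightarrow> l \<in> cell_labels c \<and> (\<forall>v. w v \<noteq> 0 \<longrightarrow> l \<in> v)"
    if "c \<in> C" "w \<in> face_weights (T c)" for c w l
  proof -
    have sub: "T c \<subseteq> polytope_type (cell_labels c) label_row (label_rhs G (fst c) r)"
      "T c \<subseteq> polytope_type (cell_labels c) label_row (label_rhs G (fst c) s)"
      using Tr[of c] Ts[OF that(1)] by simp_all
    note wr = tight_weighted_sum[OF finite_cell_labels sub(1) wts(1)[OF that(2)] wts(2)[OF that(2)]]
    note ws = tight_weighted_sum[OF finite_cell_labels sub(2) wts(1)[OF that(2)] wts(2)[OF that(2)]]
    show "P c r w \<in> cell_polytope G c r" "P c s w \<in> cell_polytope G c s"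
      unfolding P_def cell_polytope_def by (rule wr(1), rule ws(1))
    have supp: "(\<forall>v\<in>T c. w v \<noteq> 0 \<longrightarrow> l \<in> v) \<longleftrightarrow> (\<forall>v. w v \<noteq> 0 \<longrightarrow> l \<in> v)"
      using wts(3)[OF that(2)] by blast
    show "l \<in> tight (cell_labels c) label_row (label_rhs G (fst c) r) (P c r w) \<longleftrightarrow> l \<in> cell_labels c \<and> (\<forall>v. w v \<noteq> 0 \<longrightarrow> l \<in> v)"
      "l \<in> tight (cell_labels c) label_row (label_rhs G (fst c) s) (P c s w) \<longleftrightarrow> l \<in> cell_labels c \<and> (\<forall>v. w v \<noteq> 0 \<longrightarrow> l \<in> v)"
      unfolding P_def supp[symmetric] by (rule wr(2), rule ws(2))
  qed
  have cellQ: "in_cell G c (Q c w t)"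
    if "c \<in> C" "w \<in> face_weights (T c)" "t \<in> {0..1}" for c w t
  proof -
    have "in_cell G c (P c r w)" "in_cell G c (P c s w)"
      using Pr[OF that(1,2)] Ps[OF that(1,2)] cell_polytope_iff[OF C[OF that(1)]] rs by auto
    then show ?thesis
      using that(3) unfolding in_cell_def Q_def
      by (auto simp: convex_bound_le intro!: add_nonneg_nonneg mult_nonneg_nonneg add_mono mult_left_mono)
  qed
  \<comment> \<open>The vertices of positive weight lie in every face of the cell that contains the moving point at
    one time.\<close>
  have faceQ: "face_tight G c (Q c w t) \<subseteq> v" if "c \<in> C" "w \<in> face_weights (T c)" "t \<in> {0..1}" "w v \<noteq> 0" for c w t v
  proof
    fix l assume l: "l \<in> face_tight G c (Q c w t)"
    then have lf: "l \<in> face_labels c" "l \<in> cell_labels c" by (auto simp: face_tight_def face_labels_def)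
    let ?b = "label_rhs G (fst c) (\<lambda>_ _. 0) l"
    have rhs: "label_rhs G (fst c) r l = ?b" "label_rhs G (fst c) s l = ?b"
      by (rule label_rhs_face[OF lf(1)])+
    have nn: "0 \<le> ?b - label_row l \<bullet> P c r w" "0 \<le> ?b - label_row l \<bullet> P c s w"
      using Pr[OF that(1,2)] Ps[OF that(1,2)] lf(2) rhs by (auto simp: cell_polytope_def halfspaces_def)
    have "(1 - t) * (?b - label_row l \<bullet> P c r w) + t * (?b - label_row l \<bullet> P c s w) = 0"
      using l by (simp add: face_tight_def Q_def inner_add_right algebra_simps)
    moreover have "0 \<le> (1 - t) * (?b - label_row l \<bullet> P c r w)" "0 \<le> t * (?b - label_row l \<bullet> P c s w)"
      using nn that(3) by auto
    ultimately have "(1 - t) * (?b - label_row l \<bullet> P c r w) = 0" "t * (?b - label_row l \<bullet> P c s w) = 0"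
      by linarith+
    then have "label_row l \<bullet> P c r w = ?b \<or> label_row l \<bullet> P c s w = ?b" by auto
    then have "l \<in> tight (cell_labels c) label_row (label_rhs G (fst c) r) (P c r w) \<or>
        l \<in> tight (cell_labels c) label_row (label_rhs G (fst c) s) (P c s w)"
      using lf(2) rhs by (auto simp: tight_def)
    then show "l \<in> v" using tight[OF that(1,2)] that(4) by blast
  qed
  \<comment> \<open>So the smallest face of the cell containing the moving point does not change with time.\<close>
  have faceQQ: "face_tight G c (Q c w t) \<subseteq> face_tight G c (Q c w u)"
    if "c \<in> C" "w \<in> face_weights (T c)" "t \<in> {0..1}" "u \<in> {0..1}" for c w t u
  proof
    fix l assume l: "l \<in> face_tight G c (Q c w t)"
    then have lf: "l \<in> face_labels c" "l \<in> cell_labels c" by (auto simp: face_tight_def face_labels_def)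
    have "\<forall>v. w v \<noteq> 0 \<longrightarrow> l \<in> v" using faceQ[OF that(1-3)] l by blast
    then have "l \<in> tight (cell_labels c) label_row (label_rhs G (fst c) r) (P c r w)"
      "l \<in> tight (cell_labels c) label_row (label_rhs G (fst c) s) (P c s w)"
      using tight[OF that(1,2)] lf(2) by blast+
    then show "l \<in> face_tight G c (Q c w u)"
      using lf(1) label_rhs_face[OF lf(1), of G r] label_rhs_face[OF lf(1), of G s]
      by (simp add: face_tight_def tight_def Q_def inner_add_right algebra_simps)
  qed
  have sep: "F c (w, u) = F c' (w', u)"
    if c: "c \<in> C" "c' \<in> C" and w: "w \<in> face_weights (T c)" "w' \<in> face_weights (T c')"
      and t: "t \<in> {0..1}" and u: "u \<in> {0..1}" and eq: "F c (w, t) = F c' (w', t)" for c c' w w' t u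
  proof -
    define x where "x = Q c w t"
    define x' where "x' = Q c' w' t"
    have x: "in_cell G c x" "in_cell G c' x'" "point_of G c x = point_of G c' x'"
      using cellQ c w t eq by (auto simp: x_def x'_def F_def)
    note tr = translates_face_cells[OF C[OF c(1)] C[OF c(2)] x]
    \<comment> \<open>The weights of the motion in \<open>c'\<close> that runs parallel to the given one in \<open>c\<close>; at time \<open>t\<close> it
      meets the motion with weights \<open>w'\<close>, so both have the same weights.\<close>
    obtain z where z: "z \<in> face_weights (T c')" "P c' r z = P c r w + (x' - x)" "P c' s z = P c s w + (x' - x)"
      using transport_face_weights[OF finite_cell_labels finite_cell_labels tr[OF rs(1)] tr[OF rs(2)]
          Tr Ts[OF c(1)] Tr Ts[OF c(2)] w(1)] faceQ[OF c(1) w(1) t]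
      unfolding P_def x_def by blast
    have Qz: "Q c' z u = Q c w u + (x' - x)" for u
      unfolding Q_def z(2,3) by (simp add: algebra_simps)
    have "z = w'"
    proof (rule interpolated_weights_determined[OF finite_cell_labels Tr Ts[OF c(2)] z(1) w(2) t])
      have "Q c' z t = Q c' w' t" using Qz[of t] by (simp add: x_def x'_def)
      then show "(1 - t) *\<^sub>R (\<Sum>v\<in>T c'. z v *\<^sub>R vertex_of (cell_labels c') label_row (label_rhs G (fst c') r) v) +
          t *\<^sub>R (\<Sum>v\<in>T c'. z v *\<^sub>R vertex_of (cell_labels c') label_row (label_rhs G (fst c') s) v) =
          (1 - t) *\<^sub>R (\<Sum>v\<in>T c'. w' v *\<^sub>R vertex_of (cell_labels c') label_row (label_rhs G (fst c') r) v) +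
          t *\<^sub>R (\<Sum>v\<in>T c'. w' v *\<^sub>R vertex_of (cell_labels c') label_row (label_rhs G (fst c') s) v)"
        by (simp add: Q_def P_def)
    qed
    then have "Q c' w' u = Q c w u + (x' - x)" using Qz by simp
    moreover have "point_of G c' (Q c w u + (x' - x)) = point_of G c (Q c w u)"
      using cellQ[OF c(1) w(1) u] faceQQ[OF c(1) w(1) t u]
      by (intro face_in_neighbouring_cell(3)[OF C[OF c(1)] C[OF c(2)] x]) (auto simp: x_def)
    ultimately show ?thesis by (simp add: F_def)
  qed
  have cont: "continuous_map (prod_topology (K c) (top_of_set {0..1})) (gpower G) (F c)" if c: "c \<in> C" for c
    unfolding gpower_def continuous_map_componentwise_UNIV
  proof
    fix i
    have "continuous_on UNIV (\<lambda>w :: 'n label set \<Rightarrow> real. w v)" for v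
      by (rule continuous_on_product_coordinates)
    then have coord: "continuous_on (face_weights (T c) \<times> {0..1}) (\<lambda>z :: ('n label set \<Rightarrow> real) \<times> real. fst z v)" for v
      using continuous_on_compose2[OF _ continuous_on_fst[OF continuous_on_id]] by blast
    have "continuous_on (face_weights (T c) \<times> {0..1}) (\<lambda>z. Q c (fst z) (snd z) $ i)"
      unfolding Q_def P_def by (intro continuous_intros coord)
    then have "continuous_map (prod_topology (K c) (top_of_set {0..1})) (top_of_set {0..len G (fst c i)})
        (\<lambda>z. Q c (fst z) (snd z) $ i)"
      using cellQ[OF c] by (auto simp: K_def continuous_map_in_subtopology in_cell_def)
    from continuous_map_compose[OF this edge_facts(2)[OF max_cellsD(1)[OF C[OF c]]]]
    show "continuous_map (prod_topology (K c) (top_of_set {0..1})) (gspace G) (\<lambda>z. F c z i)"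
      by (simp add: o_def F_def point_of_def case_prod_unfold)
  qed
  have haus: "Hausdorff_space (gpower G :: ('n \<Rightarrow> 'a) topology)"
    using assms(1) by (simp add: gpower_def Hausdorff_space_product_topology metric_graph_def)
  have slice: "(\<Union>c\<in>C. (\<lambda>w. point_of G c (P c u w)) ` face_weights (T c)) = conf_space G u"
    if u: "u \<in> param_space" "\<And>c. c \<in> C \<Longrightarrow> polytope_type (cell_labels c) label_row (label_rhs G (fst c) u) = T c"
      "\<And>c w. c \<in> C \<Longrightarrow> w \<in> face_weights (T c) \<Longrightarrow> P c u w \<in> cell_polytope G c u" for u
  proof (intro set_eqI iffI)
    fix \<xi> assume "\<xi> \<in> (\<Union>c\<in>C. (\<lambda>w. point_of G c (P c u w)) ` face_weights (T c))"
    then show "\<xi> \<in> conf_space G u" using u(3) cell_polytope_iff[OF C u(1)] by auto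
  next
    fix \<xi> assume \<xi>: "\<xi> \<in> conf_space G u"
    then obtain c x where c: "c \<in> C" "in_cell G c x" "point_of G c x = \<xi>"
      using cell_containing_point[of \<xi>] by (auto simp: conf_space_def C_def)
    then have "x \<in> cell_polytope G c u" using \<xi> cell_polytope_iff[OF C u(1)] by simp
    then obtain w where "w \<in> face_weights (T c)" "P c u w = x"
      using point_has_face_weights[OF finite_cell_labels compact_cell_polytope[OF C[OF c(1)] u(1), unfolded cell_polytope_def]]
      unfolding cell_polytope_def u(2)[OF c(1)] P_def by blast
    then show "\<xi> \<in> (\<Union>c\<in>C. (\<lambda>w. point_of G c (P c u w)) ` face_weights (T c))"
      using c by auto
  qed
  have "isotopic_in (gpower G) (\<Union>c\<in>C. (\<lambda>w. F c (w, 0)) ` topspace (K c)) (\<Union>c\<in>C. (\<lambda>w. F c (w, 1)) ` topspace (K c))"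
  proof (rule isotopic_in_compact_family[OF haus])
    show "finite C"
      unfolding C_def using assms(1) by (intro finite_cell_representatives) (simp add: metric_graph_def)
    show "compact_space (K c)" for c
      using compact_face_weights[OF finT] by (simp add: K_def compact_space_subtopology)
    show "continuous_map (prod_topology (K c) (top_of_set {0..1})) (gpower G) (F c)" if "c \<in> C" for c
      by (rule cont[OF that])
    show "F c (w, u) = F c' (w', u)"
      if "c \<in> C" "c' \<in> C" "w \<in> topspace (K c)" "w' \<in> topspace (K c')"
        "t \<in> {0..1}" "u \<in> {0..1}" "F c (w, t) = F c' (w', t)" for c c' w w' t u
      by (rule sep[OF that(1,2) _ _ that(5-7)]) (use that(3,4) in \<open>simp_all add: K_def\<close>)
  qed
  moreover have "(\<Union>c\<in>C. (\<lambda>w. F c (w, 0)) ` topspace (K c)) = conf_space G r"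
    using slice[OF rs(1) Tr Pr] by (simp add: F_def Q_def K_def)
  moreover have "(\<Union>c\<in>C. (\<lambda>w. F c (w, 1)) ` topspace (K c)) = conf_space G s"
    using slice[OF rs(2) Ts Ps] by (simp add: F_def Q_def K_def)
  ultimately show ?thesis by simp
qed

end
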